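(* Let $d\ge 2$, let $\bm{\mu}=(\mu_1,\ldots,\mu_d)$ have positive entries, and put $\bm{p}=\bm{\mu}/|\bm{\mu}|$. Let $\bm{u}=\{u^{(l)}\}_{l=0}^{d-1}$ be an orthogonal basis on $\bm{p}$ with $u^{(0)}\equiv 1$, $\sum_{j=1}^d u_j^{(k)}u_j^{(l)}p_j=\delta_{kl}a_k$, scaled so that $u_d^{(r)}=1$ for $r=0,\ldots,d-1$. Suppose that the basis satisfies the hypergroup property $$\mathfrak{s}(j,k,l)=\sum_{r=0}^{d-1}a_r^{-1}u_j^{(r)}u_k^{(r)}u_l^{(r)}\ge 0,\qquad j,k,l=1,\ldots,d.$$ Let $\{\rho_{\bm{n}}\}_{\bm{n}\in\mathbb{Z}_+^d}$ be real numbers with $\rho_{\bm{0}}=1$. Then $$P(\bm{x};\bm{\mu})P(\bm{y};\bm{\mu})\Big\{1+\sum_{|\bm{n}|\ge 1}\rho_{\bm{n}}\,h_{\bm{n}}(|\bm{\mu}|,\bm{u})\,C_{\bm{n}}(\bm{x};\bm{\mu},\bm{u})\,C_{\bm{n}}(\bm{y};\bm{\mu},\bm{u})\Big\},\qquad \bm{x},\bm{y}\in\mathbb{Z}_+^d,$$ is non-negative, and thus a proper bivariate Poisson distribution (a joint distribution of a pair $(\bm{X},\bm{Y})$, each having marginal distribution $P(\cdot;\bm{\mu})$), if and only if for all $\bm{n}=(n_0,\ldots,n_{d-1})\in\mathbb{Z}_+^d$ $$\rho_{\bm{n}}=\mathbb{E}_{\bm{\xi}}\Big[\prod_{j=0}^{d-1}\rho_j(\bm{\xi})^{n_j}\Big],\qquad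 \rho_j(\bm{\xi})=\sum_{i=1}^{d}u_i^{(j)}\xi_i,$$ for some random vector $\bm{\xi}=(\xi_1,\ldots,\xi_d)$ in the unit simplex $\{\bm{\xi}:\xi_i\ge 0,\ \sum_{i=1}^d\xi_i\le 1\}$.
   Context: For a vector $\bm{z}$, $|\bm{z}|$ denotes the sum of its entries. Poisson product distribution: $P(\bm{x};\bm{\mu})=\prod_{i=1}^d e^{-\mu_i}\mu_i^{x_i}/x_i!$, $\bm{x}\in\mathbb{Z}_+^d$. A basis $\bm{u}=\{u^{(l)}\}_{l=0}^{d-1}$ is a complete set of real orthogonal functions on $\{1,\ldots,d\}$ with respect to the probability distribution $\bm{p}$; $u^{(l)}_j$ is the value of $u^{(l)}$ at $j$, and $a_0=1$. Multivariate Poisson-Charlier polynomials: for $\bm{n}=(n_0,\ldots,n_{d-1})\in\mathbb{Z}_+^d$, $C_{\bm{n}}(\bm{X};\bm{\mu},\bm{u})$ is the coefficient of $w_0^{n_0}\cdots w_{d-1}^{n_{d-1}}$ in $$e^{w_0}\prod_{i=1}^d\Big(1-|\bm{\mu}|^{-1}w_0+|\bm{\mu}|^{-1}\sum_{j=1}^{d-1}u_i^{(j)}w_j\Big)^{X_i}.$$ They are orthogonal on $P(\cdot;\bm{\mu})$, with $\mathbb{E}[C_{\bm{m}}C_{\bm{n}}]=\delta_{\bm{m}\bm{n}}h_{\bm{n}}(|\bm{\mu}|,\bm{u})^{-1}$, where $$h_{\bm{n}}(|\bm{\mu}|,\bm{u})=|\bm{\mu}|^{|\bm{n}|}\prod_{j=0}^{d-1}\frac{n_j!}{a_j^{n_j}}.$$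 In a Lancaster expansion $f(x)g(y)\{1+\sum_{n\ge1}\rho_nP_n(x)Q_n(y)\}$ with $\{P_n\},\{Q_n\}$ orthonormal on $f,g$, the sequence $\{\rho_n\}$ is by definition the correlation sequence of the pair $(X,Y)$: $\mathbb{E}[P_m(X)Q_n(Y)]=\delta_{mn}\rho_n$. Here, therefore, $\mathbb{E}[C_{\bm{m}}(\bm{X};\bm{\mu},\bm{u})C_{\bm{n}}(\bm{Y};\bm{\mu},\bm{u})]=\delta_{\bm{m}\bm{n}}\rho_{\bm{n}}h_{\bm{n}}(|\bm{\mu}|,\bm{u})^{-1}$. *)

theory Defs
  imports "HOL-Probability.Probability" "HOL-Library.Poly_Mapping"
begin

text \<open>
  Both index sets $\{1,\ldots,d\}$ (coordinates) and $\{0,\ldots,d-1\}$ (labels of basis functions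
  and variables $w_j$) are represented by one finite type of cardinality $d$, with a distinguished
  label \<open>l0\<close> (for \<open>0\<close>) and a distinguished coordinate \<open>jd\<close> (for $d$).
  The value $u^{(l)}_i$ is \<open>u l $ i\<close>.
\<close>

definition vec_total :: "('a::comm_monoid_add) ^ 'd \<Rightarrow> 'a" where
  "vec_total z = (\<Sum>i\<in>UNIV. z $ i)"

definition poisson_prod :: "real ^ 'd \<Rightarrow> nat ^ 'd \<Rightarrow> real" where
  "poisson_prod \<mu> x = (\<Prod>i\<in>UNIV. exp (- \<mu> $ i) * (\<mu> $ i) ^ (x $ i) / fact (x $ i))"

definition orthogonal_basis ::
    "real ^ 'd \<Rightarrow> ('d \<Rightarrow> real ^ 'd) \<Rightarrow> ('d \<Rightarrow> real) \<Rightarrow> bool" where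
  "orthogonal_basis p u a \<longleftrightarrow>
     (\<forall>k l. (\<Sum>j\<in>UNIV. u k $ j * u l $ j * p $ j) = (if k = l then a k else 0))"

definition hypergroup_kernel ::
    "('d::finite \<Rightarrow> real ^ 'd) \<Rightarrow> ('d \<Rightarrow> real) \<Rightarrow> 'd \<Rightarrow> 'd \<Rightarrow> 'd \<Rightarrow> real" where
  "hypergroup_kernel u a j k l = (\<Sum>r\<in>UNIV. inverse (a r) * u r $ j * u r $ k * u r $ l)"

text \<open>
  Polynomials in the variables $w_j$ are elements of the monoid algebra of the additive monoid of
  exponent vectors; \<open>Poly_Mapping.single k c\<close> is the monomial $c\,w^k$.
\<close>

definition charlier_factor ::
    "'d \<Rightarrow> real ^ 'd \<Rightarrow> ('d \<Rightarrow> real ^ 'd) \<Rightarrow> 'd \<Rightarrow> (nat ^ 'd) \<Rightarrow>\<^sub>0 real" where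
  "charlier_factor l0 \<mu> u i =
     Poly_Mapping.single 0 1
     - Poly_Mapping.single (axis l0 1) (inverse (vec_total \<mu>))
     + (\<Sum>j\<in>UNIV - {l0}. Poly_Mapping.single (axis j 1) (inverse (vec_total \<mu>) * u j $ i))"

text \<open>
  The coefficient of $w^n$ in $e^{w_{l_0}}\prod_i (\ldots)^{x_i}$, where the factor
  $e^{w_{l_0}} = \sum_k w_{l_0}^k/k!$, which is not a polynomial, enters through the Cauchy product.
\<close>

definition charlier ::
    "'d \<Rightarrow> real ^ 'd \<Rightarrow> ('d \<Rightarrow> real ^ 'd) \<Rightarrow> nat ^ 'd \<Rightarrow> nat ^ 'd \<Rightarrow> real" where
  "charlier l0 \<mu> u n x =
     (\<Sum>k\<le>n $ l0. 1 / fact k *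
        Poly_Mapping.lookup (\<Prod>i\<in>UNIV. charlier_factor l0 \<mu> u i ^ (x $ i)) (n - axis l0 k))"

definition charlier_h :: "real ^ 'd \<Rightarrow> ('d \<Rightarrow> real) \<Rightarrow> nat ^ 'd \<Rightarrow> real" where
  "charlier_h \<mu> a n = vec_total \<mu> ^ vec_total n * (\<Prod>j\<in>UNIV. fact (n $ j) / a j ^ (n $ j))"

definition lancaster_term ::
    "'d \<Rightarrow> real ^ 'd \<Rightarrow> ('d \<Rightarrow> real ^ 'd) \<Rightarrow> ('d \<Rightarrow> real) \<Rightarrow> (nat ^ 'd \<Rightarrow> real)
      \<Rightarrow> nat ^ 'd \<Rightarrow> nat ^ 'd \<Rightarrow> nat ^ 'd \<Rightarrow> real" where
  "lancaster_term l0 \<mu> u a \<rho> x y n =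
     \<rho> n * charlier_h \<mu> a n * charlier l0 \<mu> u n x * charlier l0 \<mu> u n y"

definition lancaster ::
    "'d \<Rightarrow> real ^ 'd \<Rightarrow> ('d \<Rightarrow> real ^ 'd) \<Rightarrow> ('d \<Rightarrow> real) \<Rightarrow> (nat ^ 'd \<Rightarrow> real)
      \<Rightarrow> nat ^ 'd \<Rightarrow> nat ^ 'd \<Rightarrow> real" where
  "lancaster l0 \<mu> u a \<rho> x y =
     poisson_prod \<mu> x * poisson_prod \<mu> y *
       (1 + (\<Sum>\<^sub>\<infinity>n\<in>{n. vec_total n \<ge> 1}. lancaster_term l0 \<mu> u a \<rho> x y n))"

text \<open>
  The series converges everywhere and \<open>\<rho>\<close> is the correlation sequence of the
  resulting function, $E[C_m(X)\,C_n(Y)] = \delta_{mn}\rho_n/h_n$.  The second clause does not follow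
  from convergence, even for non-negative sums: distinct coefficient families can have pointwise
  equal, absolutely convergent expansions.
\<close>

definition lancaster_expansion ::
    "'d \<Rightarrow> real ^ 'd \<Rightarrow> ('d \<Rightarrow> real ^ 'd) \<Rightarrow> ('d \<Rightarrow> real) \<Rightarrow> (nat ^ 'd \<Rightarrow> real) \<Rightarrow> bool" where
  "lancaster_expansion l0 \<mu> u a \<rho> \<longleftrightarrow>
     (\<forall>x y. lancaster_term l0 \<mu> u a \<rho> x y summable_on {n. vec_total n \<ge> 1}) \<and>
     (\<forall>m n. ((\<lambda>(x, y). lancaster l0 \<mu> u a \<rho> x y * (charlier l0 \<mu> u m x * charlier l0 \<mu> u n y))
        has_sum (if m = n then \<rho> n * inverse (charlier_h \<mu> a n) else 0)) UNIV)"

definition bivariate_poisson :: "real ^ 'd \<Rightarrow> ((nat ^ 'd) \<times> (nat ^ 'd)) pmf \<Rightarrow> bool" where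
  "bivariate_poisson \<mu> q \<longleftrightarrow>
     (\<forall>x. pmf (map_pmf fst q) x = poisson_prod \<mu> x) \<and>
     (\<forall>y. pmf (map_pmf snd q) y = poisson_prod \<mu> y)"

definition unit_simplex :: "(real ^ 'd) set" where
  "unit_simplex = {\<xi>. (\<forall>i. 0 \<le> \<xi> $ i) \<and> vec_total \<xi> \<le> 1}"

end

theory Submission
  imports Defs
begin

text \<open>
  Write \<open>D n\<close> for the Poisson-Charlier polynomials with the sign of $w_0$ changed. Their generating
  function gives two recurrences: adding a unit vector to $x$ lowers degrees, and differentiation
  in $w_j$ expresses \<open>D\<close> of degree $n + e_j$ through values at $x - e_i$. Together they give
  orthogonality and convergence of the expansion for $|\rho_n| \le 1$.

  If $\rho_n = \prod_j \rho_j(\xi)^{n_j}$ for one fixed $\xi$ in the simplex, the two recurrences combine to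
  $$K(x + e_i, y) = (1 - |\xi|) K(x, y) + |\mu|^{-1} \sum_k y_k \Big(\sum_l \xi_l s(i, k, l)\Big) K(x, y - e_k)$$
  for the sum $K$ of the series, so $K \ge 0$ by induction; mixing over $\xi$ keeps this.

  Conversely, a non-negative expansion is a joint law under which $D_n(X)$ and $D_n(Y)$ both have second
  moment $1/h_n$, whence $|\rho_n| \le 1$. Given $Y = m e_d$ the conditional mean of $D_n(X)$ is
  $\rho_n D_n(m e_d)$; since $u^{(j)}_d = 1$ and $D_n$ has leading term $\prod_j (\sum_i u^{(j)}_i x_i)^{n_j}$
  up to a constant, the moments of $X/m$ in the coordinates $\rho_j$ converge to $\rho_n$. A limit of the
  conditional laws of $X/m$ is the law of $\xi$, and it lives on the simplex because
  $E |\xi|^k \le 1$ for all $k$.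
\<close>

section \<open>Exponent vectors and coefficient families\<close>

text \<open>The hypergroup property acts twice: for fixed j, k the weights s(j,k,l) p_l form a
  probability vector, which forces |u| <= 1 and with it every growth bound; and the s(i,k,l) are the
  coefficients of the recurrence for K, so their sign is what the induction needs. In the converse
  no bound on rho is known at the outset, so the series cannot be integrated term by term. Only the
  prescribed correlations are available, and a second moment becomes a correlation with the constant
  1 once D_n^2 is written in the span of the polynomials. This is why multiplication is studied
  along a filtration by degree. The vectors X/m are unbounded, while weak limits control only
  bounded continuous functions. The vector is therefore cut off at total 2m; any cm with c > 1 would
  do, because the limiting moments of |X|/m are at most 1. A further scaling by 1/4 puts it inside
  the unit cube. Helly's theorem concerns the line, so laws on the cube are carried to [0,1] by a
  space-filling curve; since the laws are discrete, an arbitrary choice of preimages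
  suffices.\<close>

declare One_nat_def [simp del]

lemma vec_total_add [simp]: "vec_total (x + y) = vec_total x + vec_total y"
  by (simp add: vec_total_def sum.distrib)

lemma vec_total_zero [simp]: "vec_total 0 = 0"
  by (simp add: vec_total_def)

lemma vec_total_axis [simp]: "vec_total (axis i c :: 'a::comm_monoid_add ^ 'd) = c"
  by (simp add: vec_total_def axis_def)

lemma vec_total_eq_0_iff [simp]: "vec_total (x :: nat ^ 'd) = 0 \<longleftrightarrow> x = 0"
  by (auto simp: vec_total_def vec_eq_iff)

lemma axis_le_cancel:
  assumes "(n :: nat ^ 'd) $ j \<noteq> 0"
  shows "n - axis j 1 + axis j 1 = n"
  using assms by (auto simp: vec_eq_iff axis_def)

lemma axis_add_diff [simp]: "(n :: nat ^ 'd) + axis j 1 - axis j 1 = n"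
  by (simp add: vec_eq_iff)

lemma vec_nat_induct [case_names zero add]:
  assumes "P 0" and "\<And>x i. P x \<Longrightarrow> P (x + axis i 1)"
  shows "P (x :: nat ^ 'd)"
proof (induction "vec_total x" arbitrary: x)
  case 0
  then show ?case using assms(1) by simp
next
  case (Suc k)
  then have "vec_total x \<noteq> 0" by linarith
  then have "\<not> (\<forall>i. x $ i = 0)" by (auto simp: vec_total_def)
  then obtain i where i: "x $ i \<noteq> 0" by blast
  have "vec_total (x - axis i 1) = k"
    using Suc(2) arg_cong[OF axis_le_cancel[OF i], of vec_total] by simp
  then show ?case using assms(2)[OF Suc(1)] axis_le_cancel[OF i] by metis
qed

text \<open>
  Multiplication by $w_j$, on coefficient families; it avoids the truncated subtraction
  of exponents.
\<close>

definition vshift :: "'d \<Rightarrow> (nat ^ 'd \<Rightarrow> real) \<Rightarrow> nat ^ 'd \<Rightarrow> real" where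
  "vshift j f n = (if n $ j = 0 then 0 else f (n - axis j 1))"

lemma vshift_add [simp]: "vshift j f (n + axis j 1) = f n"
  by (simp add: vshift_def axis_def)

lemma vshift_other: "i \<noteq> j \<Longrightarrow> vshift i f (n + axis j 1) = vshift i (\<lambda>n. f (n + axis j 1)) n"
proof (cases "n $ i = 0")
  case False
  assume "i \<noteq> j"
  with False have "n + axis j 1 - axis i 1 = n - axis i 1 + axis j 1"
    by (auto simp: vec_eq_iff axis_def)
  then show ?thesis using \<open>i \<noteq> j\<close> False by (simp add: vshift_def axis_def)
qed (simp add: vshift_def axis_def)

lemma lookup_times_single_0:
  fixes p :: "(nat ^ 'd) \<Rightarrow>\<^sub>0 real"
  shows "Poly_Mapping.lookup (p * Poly_Mapping.single 0 c) n = c * Poly_Mapping.lookup p n"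
proof -
  have "Poly_Mapping.lookup (p * Poly_Mapping.single 0 c) n
      = (Sum_any (\<lambda>l. Poly_Mapping.lookup p l * (Sum_any (\<lambda>q. (c when 0 = q) when n = l + q))))"
    by (simp only: lookup_mult lookup_single)
  also have "\<dots> = (Sum_any (\<lambda>l. Poly_Mapping.lookup p l * c when l = n))"
  proof (intro Sum_any.cong)
    fix l
    have "(Sum_any (\<lambda>q. (c when 0 = q) when n = l + q)) = (Sum_any (\<lambda>q. (c when n = l) when 0 = (q :: nat ^ 'd)))"
      by (rule arg_cong[where f = Sum_any]) (auto simp: when_def fun_eq_iff)
    then show "Poly_Mapping.lookup p l * (Sum_any (\<lambda>q. (c when 0 = q) when n = l + q))
        = (Poly_Mapping.lookup p l * c when l = n)"
      by (simp add: when_def)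
  qed
  finally show ?thesis by simp
qed

lemma lookup_times_single_axis:
  fixes p :: "(nat ^ 'd) \<Rightarrow>\<^sub>0 real"
  shows "Poly_Mapping.lookup (p * Poly_Mapping.single (axis j 1) c) n
    = c * vshift j (Poly_Mapping.lookup p) n"
proof -
  have "Poly_Mapping.lookup (p * Poly_Mapping.single (axis j 1) c) n
      = (Sum_any (\<lambda>l. Poly_Mapping.lookup p l * (Sum_any (\<lambda>q. (c when axis j 1 = q) when n = l + q))))"
    by (simp only: lookup_mult lookup_single)
  also have "\<dots> = (Sum_any (\<lambda>l. Poly_Mapping.lookup p l * (c when n = l + axis j 1)))"
  proof (intro Sum_any.cong)
    fix l
    have "(Sum_any (\<lambda>q. (c when axis j 1 = q) when n = l + q))
        = (Sum_any (\<lambda>q. (c when n = l + axis j 1) when axis j 1 = (q :: nat ^ 'd)))"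
      by (rule arg_cong[where f = Sum_any]) (auto simp: when_def fun_eq_iff)
    then show "Poly_Mapping.lookup p l * (Sum_any (\<lambda>q. (c when axis j 1 = q) when n = l + q))
        = Poly_Mapping.lookup p l * (c when n = l + axis j 1)"
      by simp
  qed
  also have "\<dots> = c * vshift j (Poly_Mapping.lookup p) n"
  proof (cases "n $ j = 0")
    case True
    then have "n \<noteq> l + axis j 1" for l by (auto simp: vec_eq_iff axis_def)
    with True show ?thesis by (simp add: vshift_def)
  next
    case False
    then have eq: "n = l + axis j 1 \<longleftrightarrow> l = n - axis j 1" for l
      using axis_le_cancel[OF False] by (metis axis_add_diff)
    have "(Sum_any (\<lambda>l. Poly_Mapping.lookup p l * (c when n = l + axis j 1)))
        = (Sum_any (\<lambda>l. Poly_Mapping.lookup p l * c when l = n - axis j 1))"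
      by (rule arg_cong[where f = Sum_any]) (simp add: when_def fun_eq_iff eq del: One_nat_def)
    with False show ?thesis by (simp add: vshift_def)
  qed
  finally show ?thesis .
qed

section \<open>The basis and the polynomials\<close>

locale hypergroup_basis =
  fixes \<mu> :: "real ^ 'd" and u :: "'d \<Rightarrow> real ^ 'd" and a :: "'d \<Rightarrow> real" and l0 jd :: 'd
  assumes mu_pos: "\<mu> $ i > 0"
    and orth: "orthogonal_basis (\<chi> i. \<mu> $ i / vec_total \<mu>) u a"
    and u_l0 [simp]: "u l0 $ i = 1"
    and u_jd [simp]: "u r $ jd = 1"
    and kernel_nonneg: "hypergroup_kernel u a j k l \<ge> 0"
begin

definition M :: real where "M = vec_total \<mu>"

definition p :: "'d \<Rightarrow> real" where "p i = \<mu> $ i / M"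

lemma M_pos: "M > 0"
  unfolding M_def vec_total_def by (intro sum_pos) (auto simp: mu_pos)

lemma p_pos: "p i > 0"
  by (simp add: p_def mu_pos M_pos)

lemma mu_eq: "\<mu> $ i = M * p i"
  using M_pos by (simp add: p_def)

lemma sum_p [simp]: "(\<Sum>i\<in>UNIV. p i) = 1"
  using M_pos by (simp add: p_def M_def vec_total_def flip: sum_divide_distrib)

lemma u_orth: "(\<Sum>i\<in>UNIV. u k $ i * u l $ i * p i) = (if k = l then a k else 0)"
  using orth unfolding orthogonal_basis_def p_def M_def by simp

text \<open>The coordinate \<open>jd\<close>, where every basis function is 1, alone contributes
  \<open>p jd\<close> > 0 to the squared norm.\<close>

lemma a_pos: "a r > 0"
proof -
  have "0 < u r $ jd * u r $ jd * p jd"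
    by (simp add: p_pos)
  also have "\<dots> \<le> (\<Sum>i\<in>UNIV. u r $ i * u r $ i * p i)"
    by (intro member_le_sum) (simp_all add: less_imp_le[OF p_pos])
  finally show ?thesis by (simp add: u_orth)
qed

lemma a_l0 [simp]: "a l0 = 1"
  using u_orth[of l0 l0] by simp

lemma sum_up: "(\<Sum>i\<in>UNIV. u j $ i * p i) = (if j = l0 then 1 else 0)"
  using u_orth[of j l0] by auto

text \<open>Orthogonality says that one square matrix is a left inverse of another; it is then also
  a right inverse, and this is the dual orthogonality relation.\<close>

lemma u_complete: "(\<Sum>l\<in>UNIV. u l $ j * u l $ k / a l) * p k = (if j = k then 1 else 0)"
proof -
  define X where "X = (\<chi> l j. u l $ j * p j / a l)"
  define Y where "Y = (\<chi> j l. u l $ j)"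
  have "(X ** Y) $ k $ l = mat 1 $ k $ l" for k l
  proof -
    have "(X ** Y) $ k $ l = (\<Sum>i\<in>UNIV. u k $ i * u l $ i * p i) / a k"
      by (simp add: X_def Y_def matrix_matrix_mult_def sum_divide_distrib mult_ac)
    then show ?thesis using a_pos[of k] by (auto simp: u_orth mat_def)
  qed
  then have "X ** Y = mat 1" by (simp add: vec_eq_iff)
  then have "Y ** X = mat 1"
    using matrix_left_right_inverse by blast
  then have "(Y ** X) $ j $ k = mat 1 $ j $ k" by simp
  then show ?thesis
    by (simp add: X_def Y_def matrix_matrix_mult_def mat_def sum_distrib_right sum_distrib_left mult_ac)
qed

definition fourier :: "('d \<Rightarrow> real) \<Rightarrow> 'd \<Rightarrow> real" where
  "fourier g r = (\<Sum>k\<in>UNIV. g k * u r $ k * p k) / a r"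

lemma fourier_expansion: "g i = (\<Sum>r\<in>UNIV. fourier g r * u r $ i)"
proof -
  have "(\<Sum>r\<in>UNIV. fourier g r * u r $ i)
      = (\<Sum>r\<in>UNIV. \<Sum>k\<in>UNIV. g k * (u r $ i * u r $ k / a r * p k))"
    by (simp add: fourier_def sum_distrib_right sum_divide_distrib sum_distrib_left mult_ac)
  also have "\<dots> = (\<Sum>k\<in>UNIV. g k * ((\<Sum>r\<in>UNIV. u r $ i * u r $ k / a r) * p k))"
    by (subst sum.swap) (simp add: sum_distrib_left sum_distrib_right)
  also have "\<dots> = g i"
    by (simp add: u_complete if_distrib[of "\<lambda>x. _ * x"] cong: if_cong)
  finally show ?thesis by simp
qed

abbreviation s where "s \<equiv> hypergroup_kernel u a"

lemma kernel_eigen: "(\<Sum>l\<in>UNIV. s j k l * u r $ l * p l) = u r $ j * u r $ k"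
proof -
  have "(\<Sum>l\<in>UNIV. s j k l * u r $ l * p l)
      = (\<Sum>l\<in>UNIV. \<Sum>q\<in>UNIV. u q $ j * u q $ k / a q * (u q $ l * u r $ l * p l))"
    by (simp add: hypergroup_kernel_def sum_distrib_right sum_distrib_left divide_inverse mult_ac)
  also have "\<dots> = (\<Sum>q\<in>UNIV. u q $ j * u q $ k / a q * (\<Sum>l\<in>UNIV. u q $ l * u r $ l * p l))"
    by (subst sum.swap) (simp add: sum_distrib_left)
  also have "\<dots> = u r $ j * u r $ k"
    using a_pos[of r] by (simp add: u_orth if_distrib[of "\<lambda>x. _ * x"] cong: if_cong)
  finally show ?thesis .
qed

text \<open>By the previous identity the product of two values of $u^{(r)}$ is an average of its values.\<close>

lemma u_abs_le_1: "\<bar>u r $ i\<bar> \<le> 1"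
proof -
  define m where "m = Max (range (\<lambda>i. \<bar>u r $ i\<bar>))"
  have le: "\<bar>u r $ l\<bar> \<le> m" for l
    unfolding m_def by (intro Max_ge) auto
  have "m \<in> range (\<lambda>i. \<bar>u r $ i\<bar>)"
    unfolding m_def by (intro Max_in) auto
  then obtain j where j: "m = \<bar>u r $ j\<bar>" by blast
  \<comment> \<open>At a maximiser \<open>j\<close> of |u^(r)| the square m^2 is an average of
    values of modulus at most m, whence m^2 <= m.\<close>
  have "m * m = \<bar>\<Sum>l\<in>UNIV. s j j l * u r $ l * p l\<bar>"
    by (simp add: kernel_eigen j abs_mult)
  also have "\<dots> \<le> (\<Sum>l\<in>UNIV. \<bar>s j j l * u r $ l * p l\<bar>)"
    by (rule sum_abs)
  \<comment> \<open>The factor \<open>u l0 $ l\<close> = 1 is inserted so that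
    \<open>kernel_eigen\<close> at \<open>l0\<close> gives the total weight 1.\<close>
  also have "\<dots> \<le> (\<Sum>l\<in>UNIV. m * (s j j l * u l0 $ l * p l))"
  proof (intro sum_mono)
    fix l
    have "\<bar>s j j l * u r $ l * p l\<bar> = \<bar>u r $ l\<bar> * (s j j l * p l)"
      using p_pos[of l] kernel_nonneg[of j j l] by (simp add: abs_mult)
    also have "\<dots> \<le> m * (s j j l * p l)"
      using p_pos[of l] kernel_nonneg[of j j l] by (intro mult_right_mono le) auto
    finally show "\<bar>s j j l * u r $ l * p l\<bar> \<le> m * (s j j l * u l0 $ l * p l)" by simp
  qed
  also have "\<dots> = m"
    using kernel_eigen[of j j l0] by (simp flip: sum_distrib_left)
  finally have "m * m \<le> m" .
  moreover have "m * 1 < m * m" if "m > 1"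
    using that by (intro mult_strict_left_mono) auto
  ultimately have "m \<le> 1" by fastforce
  with le[of i] show ?thesis by simp
qed

text \<open>
  The sign makes the generating function $e^{-w_0} \prod_i (1 + |\mu|^{-1} \sum_j u^{(j)}_i w_j)^{x_i}$
  uniform in the variables $w_j$.
\<close>

definition D :: "nat ^ 'd \<Rightarrow> nat ^ 'd \<Rightarrow> real" where
  "D n x = (- 1) ^ (n $ l0) * charlier l0 \<mu> u n x"

definition G :: "nat ^ 'd \<Rightarrow> nat ^ 'd \<Rightarrow> real" where
  "G x = Poly_Mapping.lookup (\<Prod>i\<in>UNIV. charlier_factor l0 \<mu> u i ^ (x $ i))"

lemma charlier_G: "charlier l0 \<mu> u n x = (\<Sum>k\<le>n $ l0. 1 / fact k * G x (n - axis l0 k))"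
  by (simp add: charlier_def G_def)

definition sg :: "'d \<Rightarrow> real" where "sg j = (if j = l0 then - 1 else 1)"

lemma G_step: "G (x + axis i 1) n = G x n + (\<Sum>j\<in>UNIV. sg j * u j $ i / M * vshift j (G x) n)"
proof -
  let ?f = "charlier_factor l0 \<mu> u"
  have "(\<Prod>k\<in>UNIV. ?f k ^ ((x + axis i 1) $ k)) = (\<Prod>k\<in>UNIV. ?f k ^ (x $ k) * ?f k ^ (axis i 1 $ k))"
    by (simp add: power_add)
  also have "\<dots> = (\<Prod>k\<in>UNIV. ?f k ^ (x $ k)) * (\<Prod>k\<in>UNIV. ?f k ^ (axis i 1 $ k))"
    by (simp add: prod.distrib)
  also have "(\<Prod>k\<in>UNIV. ?f k ^ (axis i 1 $ k)) = (\<Prod>k\<in>UNIV. if k = i then ?f k else 1)"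
    by (intro prod.cong) (auto simp: axis_def)
  also have "\<dots> = ?f i" by simp
  finally have "(\<Prod>k\<in>UNIV. ?f k ^ ((x + axis i 1) $ k)) = (\<Prod>k\<in>UNIV. ?f k ^ (x $ k)) * ?f i" .
  moreover define q where "q = (\<Prod>k\<in>UNIV. ?f k ^ (x $ k))"
  ultimately have "G (x + axis i 1) n = Poly_Mapping.lookup (q * ?f i) n"
    by (simp only: G_def)
  also have "\<dots> = Poly_Mapping.lookup q n - 1 / M * vshift l0 (Poly_Mapping.lookup q) n
      + (\<Sum>j\<in>UNIV - {l0}. u j $ i / M * vshift j (Poly_Mapping.lookup q) n)"
    unfolding charlier_factor_def M_def
    by (simp only: distrib_left right_diff_distrib lookup_add lookup_minus sum_distrib_left lookup_sum
        lookup_times_single_0 lookup_times_single_axis divide_inverse mult_1_left mult.commute[of _ "u _ $ i"])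
  finally have "G (x + axis i 1) n = G x n - 1 / M * vshift l0 (G x) n
      + (\<Sum>j\<in>UNIV - {l0}. u j $ i / M * vshift j (G x) n)"
    by (simp only: G_def q_def)
  also have "(\<Sum>j\<in>UNIV. sg j * u j $ i / M * vshift j (G x) n)
      = - 1 / M * vshift l0 (G x) n + (\<Sum>j\<in>UNIV - {l0}. u j $ i / M * vshift j (G x) n)"
    by (subst sum.remove[of _ l0]) (auto simp: sg_def intro!: sum.cong)
  ultimately show ?thesis by simp
qed

text \<open>Convolution with the coefficients of e^{w_0} commutes with multiplication by each w_j,
  so \<open>G_step\<close> carries over. For j = \<open>l0\<close> the two truncated sums differ
  only in the top term k = n_0, where the shift is zero.\<close>

lemma charlier_step:
  "charlier l0 \<mu> u n (x + axis i 1)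
    = charlier l0 \<mu> u n x + (\<Sum>j\<in>UNIV. sg j * u j $ i / M * vshift j (\<lambda>n. charlier l0 \<mu> u n x) n)"
proof -
  have sh: "(\<Sum>k\<le>n $ l0. 1 / fact k * vshift j (G x) (n - axis l0 k))
      = vshift j (\<lambda>n. charlier l0 \<mu> u n x) n" for j
  proof (cases "j = l0")
    case False
    then have "(n - axis l0 k) $ j = n $ j" "n - axis l0 k - axis j 1 = n - axis j 1 - axis l0 k"
        "(n - axis j 1) $ l0 = n $ l0" for k
      by (auto simp: axis_def vec_eq_iff)
    then show ?thesis by (simp add: vshift_def charlier_G)
  next
    case True
    show ?thesis
    proof (cases "n $ l0")
      case 0
      then show ?thesis by (simp add: True vshift_def)
    next
      case (Suc m)
      have e: "vshift l0 (G x) (n - axis l0 k) = G x (n - axis l0 1 - axis l0 k)" if "k \<le> m" for k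
      proof -
        have "n - axis l0 k - axis l0 1 = n - axis l0 1 - axis l0 k"
          by (auto simp: axis_def vec_eq_iff)
        then show ?thesis using that Suc by (simp add: vshift_def axis_def)
      qed
      have "vshift l0 (G x) (n - axis l0 (Suc m)) = 0"
        using Suc by (simp add: vshift_def axis_def)
      with e have "(\<Sum>k\<le>Suc m. 1 / fact k * vshift l0 (G x) (n - axis l0 k))
          = (\<Sum>k\<le>m. 1 / fact k * G x (n - axis l0 1 - axis l0 k))"
        by simp
      then show ?thesis using Suc by (simp add: True vshift_def charlier_G)
    qed
  qed
  have "charlier l0 \<mu> u n (x + axis i 1) = charlier l0 \<mu> u n x
      + (\<Sum>k\<le>n $ l0. \<Sum>j\<in>UNIV. sg j * u j $ i / M * (1 / fact k * vshift j (G x) (n - axis l0 k)))"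
    by (simp only: charlier_G G_step) (simp add: algebra_simps sum.distrib sum_distrib_left)
  also have "(\<Sum>k\<le>n $ l0. \<Sum>j\<in>UNIV. sg j * u j $ i / M * (1 / fact k * vshift j (G x) (n - axis l0 k)))
      = (\<Sum>j\<in>UNIV. sg j * u j $ i / M * vshift j (\<lambda>n. charlier l0 \<mu> u n x) n)"
    by (subst sum.swap) (simp only: sh flip: sum_distrib_left)
  finally show ?thesis .
qed

text \<open>Lowering n_0 by one flips the sign in \<open>D\<close>, and this absorbs
  \<open>sg\<close>.\<close>

lemma D_step: "D n (x + axis i 1) = D n x + (\<Sum>j\<in>UNIV. u j $ i / M * vshift j (\<lambda>n. D n x) n)"
proof -
  have e: "(- 1) ^ (n $ l0) * (sg j * u j $ i / M * vshift j (\<lambda>n. charlier l0 \<mu> u n x) n)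
      = u j $ i / M * vshift j (\<lambda>n. D n x) n" for j
  proof (cases "n $ j")
    case (Suc m)
    then show ?thesis by (auto simp: vshift_def D_def sg_def axis_def)
  qed (simp add: vshift_def)
  have "D n (x + axis i 1) = D n x
      + (\<Sum>j\<in>UNIV. (- 1) ^ (n $ l0) * (sg j * u j $ i / M * vshift j (\<lambda>n. charlier l0 \<mu> u n x) n))"
    by (simp only: D_def charlier_step distrib_left sum_distrib_left)
  then show ?thesis by (simp only: e)
qed

text \<open>At x = 0 only the factor e^{-w_0} of the generating function is left.\<close>

lemma D_0_right: "D n 0 = (if \<forall>j. j \<noteq> l0 \<longrightarrow> n $ j = 0 then (- 1) ^ (n $ l0) / fact (n $ l0) else 0)"
proof -
  have G0: "G 0 m = (if m = 0 then 1 else 0)" for m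
    by (simp add: G_def lookup_one when_def)
  have "n - axis l0 k = 0 \<longleftrightarrow> k = n $ l0 \<and> (\<forall>j. j \<noteq> l0 \<longrightarrow> n $ j = 0)" if "k \<le> n $ l0" for k
    using that by (auto simp: vec_eq_iff axis_def)
  then have "charlier l0 \<mu> u n 0
      = (\<Sum>k\<le>n $ l0. if k = n $ l0 then (if \<forall>j. j \<noteq> l0 \<longrightarrow> n $ j = 0 then 1 / fact k else 0) else 0)"
    unfolding charlier_G G0 by (intro sum.cong) auto
  also have "\<dots> = (if \<forall>j. j \<noteq> l0 \<longrightarrow> n $ j = 0 then 1 / fact (n $ l0) else 0)"
    by (subst sum.delta) auto
  finally show ?thesis by (auto simp: D_def)
qed

lemma D_0_left [simp]: "D 0 x = 1"
  by (induction x rule: vec_nat_induct) (simp_all add: D_0_right D_step vshift_def)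

end

lemma vshift_sum: "vshift j (\<lambda>n. \<Sum>i\<in>A. f i n) n = (\<Sum>i\<in>A. vshift j (f i) n)"
  by (simp add: vshift_def)

lemma vshift_cmult: "vshift j (\<lambda>n. c * f n) n = c * vshift j f n"
  by (simp add: vshift_def)

definition vfact :: "nat ^ 'd \<Rightarrow> real" where
  "vfact n = (\<Prod>j\<in>UNIV. fact (n $ j))"

lemma vfact_pos [simp]: "vfact n > 0"
  by (simp add: vfact_def prod_pos)

text \<open>Common source of the recurrences for the factorials, the Poisson weights,
  \<open>h\<close> and the monomials \<open>monp\<close>: only the factor at \<open>j\<close>
  changes.\<close>

lemma prod_add_axis:
  fixes f :: "'d::finite \<Rightarrow> nat \<Rightarrow> 'a::comm_monoid_mult"
  assumes "f j (Suc (n $ j)) = c * f j (n $ j)"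
  shows "(\<Prod>i\<in>UNIV. f i ((n + axis j 1) $ i)) = c * (\<Prod>i\<in>UNIV. f i (n $ i))"
proof -
  have "(\<Prod>i\<in>UNIV - {j}. f i ((n + axis j 1) $ i)) = (\<Prod>i\<in>UNIV - {j}. f i (n $ i))"
    by (intro prod.cong) (auto simp: axis_def)
  then have "(\<Prod>i\<in>UNIV. f i ((n + axis j 1) $ i)) = f j (Suc (n $ j)) * (\<Prod>i\<in>UNIV - {j}. f i (n $ i))"
    by (subst prod.remove[of _ j]) (auto simp: Suc_eq_plus1)
  also have "\<dots> = c * (\<Prod>i\<in>UNIV. f i (n $ i))"
    by (subst prod.remove[of UNIV j "\<lambda>i. f i (n $ i)"]) (auto simp: assms mult_ac)
  finally show ?thesis .
qed

lemma vfact_add: "vfact (n + axis j 1) = (n $ j + 1) * vfact n"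
  unfolding vfact_def by (rule prod_add_axis) simp

text \<open>The first two terms of the binomial expansion; with c = 1/M it is the inductive step of
  \<open>D_bound\<close>.\<close>

lemma power_add_ge:
  fixes A c :: real
  assumes "A \<ge> 0" "c \<ge> 0"
  shows "A ^ N + N * A ^ (N - 1) * c \<le> (A + c) ^ N"
proof (induction N)
  case (Suc N)
  have "A ^ Suc N + Suc N * A ^ N * c \<le> (A + c) * (A ^ N + N * A ^ (N - 1) * c)"
    using assms by (cases N) (auto simp: algebra_simps)
  also have "\<dots> \<le> (A + c) * (A + c) ^ N"
    using assms Suc.IH by (intro mult_left_mono) auto
  finally show ?case by simp
qed simp

section \<open>Degree lowering and the size of the polynomials\<close>

context hypergroup_basis
begin

text \<open>The derivative of the generating function in $w_j$, compared coefficientwise.\<close>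

lemma D_lower:
  "(real (n $ j) + 1) * D (n + axis j 1) x
    = (\<Sum>i\<in>UNIV. x $ i * u j $ i / M * D n (x - axis i 1)) - (if j = l0 then D n x else 0)"
proof (induction x arbitrary: n rule: vec_nat_induct)
  case zero
  show ?case
  proof (cases "j = l0")
    case True
    have *: "(\<forall>i. i \<noteq> l0 \<longrightarrow> n $ i = 0 \<and> axis l0 (1::nat) $ i = 0) \<longleftrightarrow> (\<forall>i. i \<noteq> l0 \<longrightarrow> n $ i = 0)"
      by (auto simp: axis_def)
    show ?thesis
    proof (cases "\<forall>i. i \<noteq> l0 \<longrightarrow> n $ i = 0")
      case T: True
      have "(real (n $ l0) + 1) * ((- 1) ^ Suc (n $ l0) / fact (Suc (n $ l0))) = - ((- 1) ^ (n $ l0) / fact (n $ l0))"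
        by (simp only: fact_Suc of_nat_Suc power_Suc) (simp add: add.commute[of "real (n $ l0)"])
      moreover have "D n 0 = (- 1) ^ (n $ l0) / fact (n $ l0)"
        using T by (simp add: D_0_right)
      moreover have "D (n + axis l0 1) 0 = (- 1) ^ Suc (n $ l0) / fact (Suc (n $ l0))"
        using T * unfolding D_0_right by (auto simp: Suc_eq_plus1 simp del: fact_Suc power_Suc)
      ultimately show ?thesis by (simp add: True)
    next
      case False
      then show ?thesis unfolding True D_0_right by (auto simp: *)
    qed
  next
    case False
    then have "\<not> (\<forall>i. i \<noteq> l0 \<longrightarrow> (n + axis j 1) $ i = 0)"
      by (auto simp: axis_def intro!: exI[of _ j])
    then show ?thesis using False by (simp only: D_0_right) simp
  qed
next
  case (add x k)
  define N where "N n = (\<Sum>i\<in>UNIV. x $ i * u j $ i / M * D n (x - axis i 1))" for n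
  define e :: real where "e = (if j = l0 then 1 else 0)"
  have IH: "(real (n $ j) + 1) * D (n + axis j 1) x = N n - e * D n x" for n
    using add.IH[of n] by (simp add: N_def e_def)
  \<comment> \<open>For l = j the hypothesis at n - e_j carries the factor n_j instead of n_j + 1;
    the difference is the extra term \<open>D n x\<close>.\<close>
  have sh: "(real (n $ j) + 1) * vshift l (\<lambda>n. D n x) (n + axis j 1)
      = (if l = j then D n x else 0) + vshift l N n - e * vshift l (\<lambda>n. D n x) n" for l
  proof (cases "l = j")
    case True
    have "real (n $ j) * D n x = vshift j N n - e * vshift j (\<lambda>n. D n x) n"
    proof (cases "n $ j = 0")
      case False
      then show ?thesis using IH[of "n - axis j 1"]
        by (simp add: axis_le_cancel vshift_def)
    qed (simp add: vshift_def)
    then show ?thesis using True by (simp add: algebra_simps)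
  next
    case False
    then show ?thesis using IH[of "n - axis l 1"]
      by (auto simp: vshift_other) (auto simp: vshift_def axis_def)
  qed
  have "(real (n $ j) + 1) * D (n + axis j 1) (x + axis k 1)
      = (real (n $ j) + 1) * D (n + axis j 1) x
        + (\<Sum>l\<in>UNIV. u l $ k / M * ((real (n $ j) + 1) * vshift l (\<lambda>n. D n x) (n + axis j 1)))"
    by (simp add: D_step algebra_simps sum_distrib_left add_divide_distrib)
  also have "\<dots> = N n - e * D n x + (\<Sum>l\<in>UNIV. (if l = j then u l $ k / M * D n x else 0)
      + u l $ k / M * vshift l N n - e * (u l $ k / M * vshift l (\<lambda>n. D n x) n))"
    unfolding IH sh by (intro arg_cong2[where f = "(+)"] sum.cong) (auto simp: algebra_simps)
  also have "\<dots> = u j $ k / M * D n x + (N n + (\<Sum>l\<in>UNIV. u l $ k / M * vshift l N n))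
      - e * D n (x + axis k 1)"
    by (simp add: sum.distrib sum_subtractf sum_distrib_left D_step algebra_simps)
  also have "N n + (\<Sum>l\<in>UNIV. u l $ k / M * vshift l N n)
      = (\<Sum>i\<in>UNIV. x $ i * u j $ i / M * D n (x + axis k 1 - axis i 1))"
  proof -
    have "(\<Sum>l\<in>UNIV. u l $ k / M * vshift l N n)
        = (\<Sum>i\<in>UNIV. x $ i * u j $ i / M * (\<Sum>l\<in>UNIV. u l $ k / M * vshift l (\<lambda>n. D n (x - axis i 1)) n))"
      unfolding N_def vshift_sum vshift_cmult sum_distrib_left
      by (subst sum.swap) (simp add: mult_ac)
    then have "N n + (\<Sum>l\<in>UNIV. u l $ k / M * vshift l N n)
        = (\<Sum>i\<in>UNIV. x $ i * u j $ i / M * D n (x - axis i 1 + axis k 1))"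
      by (simp only: N_def D_step distrib_left sum.distrib)
    also have "\<dots> = (\<Sum>i\<in>UNIV. x $ i * u j $ i / M * D n (x + axis k 1 - axis i 1))"
    proof (intro sum.cong refl)
      fix i
      show "x $ i * u j $ i / M * D n (x - axis i 1 + axis k 1)
          = x $ i * u j $ i / M * D n (x + axis k 1 - axis i 1)"
      \<comment> \<open>For x_i = 0 the truncated subtraction makes the two arguments differ, but
        the coefficient is zero.\<close>
      proof (cases "x $ i = 0")
        case False
        then have "x - axis i 1 + axis k 1 = x + axis k 1 - axis i 1"
          by (auto simp: vec_eq_iff axis_def)
        then show ?thesis by simp
      qed simp
    qed
    finally show ?thesis .
  qed
  also have "u j $ k / M * D n x + (\<Sum>i\<in>UNIV. x $ i * u j $ i / M * D n (x + axis k 1 - axis i 1))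
      = (\<Sum>i\<in>UNIV. (x + axis k 1) $ i * u j $ i / M * D n (x + axis k 1 - axis i 1))"
  proof -
    have "(\<Sum>i\<in>UNIV. (x + axis k 1) $ i * u j $ i / M * D n (x + axis k 1 - axis i 1))
        = (\<Sum>i\<in>UNIV. x $ i * u j $ i / M * D n (x + axis k 1 - axis i 1)
            + (if i = k then u j $ k / M * D n x else 0))"
      by (intro sum.cong) (auto simp: axis_def algebra_simps add_divide_distrib axis_add_diff[unfolded axis_def])
    then show ?thesis by (simp add: sum.distrib)
  qed
  finally show ?case by (simp add: e_def)
qed

text \<open>Because |u| <= 1, the generating function is dominated coefficientwise by exp((1 +
  |x|/M) (sum of the w_j)), whose coefficients are the right-hand side.\<close>

lemma D_bound: "\<bar>D n x\<bar> \<le> (1 + vec_total x / M) ^ vec_total n / vfact n"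
proof (induction x arbitrary: n rule: vec_nat_induct)
  case zero
  show ?case
  proof (cases "\<forall>j. j \<noteq> l0 \<longrightarrow> n $ j = 0")
    case True
    then have "vfact n = fact (n $ l0)"
      unfolding vfact_def by (subst prod.remove[of _ l0]) auto
    then show ?thesis using True by (simp add: D_0_right power_abs)
  next
    case False
    then have "D n 0 = 0" by (simp add: D_0_right)
    then show ?thesis by (simp add: less_imp_le)
  qed
next
  case (add x i)
  define A where "A = 1 + vec_total x / M"
  have A: "A \<ge> 0" using M_pos by (simp add: A_def)
  have t: "\<bar>u j $ i / M * vshift j (\<lambda>n. D n x) n\<bar> \<le> n $ j * A ^ (vec_total n - 1) * (1 / M) / vfact n" for j
  proof (cases "n $ j = 0")
    case False
    define m where "m = n - axis j 1"
    have n: "n = m + axis j 1" using axis_le_cancel[OF False] by (simp add: m_def)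
    have "\<bar>u j $ i / M * D m x\<bar> \<le> 1 / M * (A ^ vec_total m / vfact m)"
      unfolding abs_mult using add.IH[of m] u_abs_le_1[of j i] M_pos
      by (intro mult_mono) (auto simp: A_def divide_right_mono)
    also have "\<dots> = n $ j * A ^ (vec_total n - 1) * (1 / M) / vfact n"
      unfolding n vfact_add using vfact_pos[of m] M_pos by (simp add: divide_simps del: vfact_pos)
    finally show ?thesis by (simp add: n)
  qed (simp add: vshift_def)
  have "\<bar>D n (x + axis i 1)\<bar> \<le> \<bar>D n x\<bar> + (\<Sum>j\<in>UNIV. \<bar>u j $ i / M * vshift j (\<lambda>n. D n x) n\<bar>)"
    unfolding D_step by (intro order_trans[OF abs_triangle_ineq] add_left_mono sum_abs)
  also have "\<dots> \<le> A ^ vec_total n / vfact n + (\<Sum>j\<in>UNIV. n $ j * A ^ (vec_total n - 1) * (1 / M) / vfact n)"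
    using add.IH[of n] by (intro add_mono sum_mono t) (simp add: A_def)
  also have "\<dots> = (A ^ vec_total n + vec_total n * A ^ (vec_total n - 1) * (1 / M)) / vfact n"
    by (simp add: add_divide_distrib vec_total_def sum_distrib_right sum_divide_distrib)
  also have "\<dots> \<le> (A + 1 / M) ^ vec_total n / vfact n"
    using A M_pos by (intro divide_right_mono power_add_ge) (auto simp: less_imp_le)
  also have "A + 1 / M = 1 + vec_total (x + axis i 1) / M"
    by (simp add: A_def add_divide_distrib)
  finally show ?case .
qed

end

section \<open>Poisson expectations and orthogonality\<close>

text \<open>A finite set of index vectors lies in a box, over which the sum of products is a product
  of finite sums. This bounds all finite sums, and the resulting summability is what the product
  formula requires.\<close>

lemma has_sum_prod_vec:
  fixes f :: "'d::finite \<Rightarrow> nat \<Rightarrow> real"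
  assumes nonneg: "\<And>i k. f i k \<ge> 0" and f: "\<And>i. (f i has_sum S i) UNIV"
  shows "((\<lambda>x :: nat ^ 'd. \<Prod>i\<in>UNIV. f i (x $ i)) has_sum (\<Prod>i\<in>UNIV. S i)) UNIV"
proof -
  let ?F = "\<lambda>g :: 'd \<Rightarrow> nat. \<Prod>i\<in>UNIV. f i (g i)"
  have "sum ?F X \<le> (\<Prod>i\<in>UNIV. S i)" if "finite X" for X
  proof -
    define N where "N = Max (insert 0 ((\<lambda>(g, i). g i) ` (X \<times> UNIV)))"
    have "g i \<le> N" if "g \<in> X" for g i
      unfolding N_def using that \<open>finite X\<close> by (intro Max_ge) auto
    then have "X \<subseteq> (UNIV \<rightarrow>\<^sub>E {..N})" by auto
    then have "sum ?F X \<le> sum ?F (UNIV \<rightarrow>\<^sub>E {..N})"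
      by (intro sum_mono2) (auto intro: prod_nonneg nonneg finite_PiE)
    also have "\<dots> = (\<Prod>i\<in>UNIV. \<Sum>k\<le>N. f i k)"
      by (simp add: prod_sum_PiE)
    also have "\<dots> \<le> (\<Prod>i\<in>UNIV. S i)"
      by (intro prod_mono conjI sum_nonneg nonneg finite_sum_le_has_sum[OF f]) auto
    finally show ?thesis .
  qed
  then have summ: "?F summable_on UNIV"
    by (intro nonneg_bdd_above_summable_on prod_nonneg bdd_aboveI[where M = "\<Prod>i\<in>UNIV. S i"]) (auto simp: nonneg)
  have "infsum ?F (UNIV \<rightarrow>\<^sub>E UNIV) = (\<Prod>i\<in>UNIV. infsum (f i) UNIV)"
    using summ f by (intro infsum_prod_PiE) (auto simp: summable_on_def)
  then have "infsum ?F UNIV = (\<Prod>i\<in>UNIV. S i)"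
    using infsumI[OF f] by simp
  then have "(?F has_sum (\<Prod>i\<in>UNIV. S i)) UNIV"
    using summ by (metis has_sum_infsum)
  moreover have "bij_betw (vec_nth :: nat ^ 'd \<Rightarrow> _) UNIV UNIV"
    by (rule bij_betwI[of _ _ _ vec_lambda]) auto
  ultimately show ?thesis
    by (subst has_sum_reindex_bij_betw[of vec_nth UNIV UNIV ?F, symmetric, THEN sym]) 
qed

lemma exp_has_sum: "((\<lambda>k. t ^ k / fact k) has_sum exp t) UNIV" for t :: real
proof (rule norm_summable_imp_has_sum)
  show "summable (\<lambda>k. norm (t ^ k / fact k))"
    using summable_norm_exp[of t] by (simp add: divide_inverse mult_ac)
  show "(\<lambda>k. t ^ k / fact k) sums exp t"
    using exp_converges[of t] by (simp add: divide_inverse mult_ac)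
qed

text \<open>A class of functions closed under the operations in the two recurrences, containing
  every \<open>D n\<close>, and summable against Poisson weights. The condition t >= 1 makes the
  bound monotone in the total, as \<open>exp_bounded_minus\<close> needs.\<close>

definition exp_bounded :: "(nat ^ 'd \<Rightarrow> real) \<Rightarrow> bool" where
  "exp_bounded f \<longleftrightarrow> (\<exists>C t. C \<ge> 0 \<and> t \<ge> 1 \<and> (\<forall>x. \<bar>f x\<bar> \<le> C * t ^ vec_total x))"

lemma exp_boundedI: "C \<ge> 0 \<Longrightarrow> t \<ge> 1 \<Longrightarrow> (\<And>x. \<bar>f x\<bar> \<le> C * t ^ vec_total x) \<Longrightarrow> exp_bounded f"
  by (auto simp: exp_bounded_def)

lemma exp_bounded_const: "exp_bounded (\<lambda>x. c)"
  by (rule exp_boundedI[of "\<bar>c\<bar>" 1]) auto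

lemma exp_bounded_mult:
  assumes "exp_bounded f" "exp_bounded g"
  shows "exp_bounded (\<lambda>x. f x * g x)"
proof -
  from assms obtain C t C' t' where *: "C \<ge> 0" "t \<ge> 1" "\<And>x. \<bar>f x\<bar> \<le> C * t ^ vec_total x"
    "C' \<ge> 0" "t' \<ge> 1" "\<And>x. \<bar>g x\<bar> \<le> C' * t' ^ vec_total x"
    unfolding exp_bounded_def by blast
  show ?thesis
  proof (rule exp_boundedI[of "C * C'" "t * t'"])
    fix x
    have "\<bar>f x\<bar> * \<bar>g x\<bar> \<le> (C * t ^ vec_total x) * (C' * t' ^ vec_total x)"
      using * by (intro mult_mono) auto
    then show "\<bar>f x * g x\<bar> \<le> C * C' * (t * t') ^ vec_total x"
      by (simp add: abs_mult power_mult_distrib mult_ac)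
  qed (use * mult_mono[of 1 t 1 t'] in auto)
qed

lemma exp_bounded_add:
  assumes "exp_bounded f" "exp_bounded g"
  shows "exp_bounded (\<lambda>x. f x + g x)"
proof -
  from assms obtain C t C' t' where *: "C \<ge> 0" "t \<ge> 1" "\<And>x. \<bar>f x\<bar> \<le> C * t ^ vec_total x"
    "C' \<ge> 0" "t' \<ge> 1" "\<And>x. \<bar>g x\<bar> \<le> C' * t' ^ vec_total x"
    unfolding exp_bounded_def by blast
  show ?thesis
  proof (rule exp_boundedI[of "C + C'" "max t t'"])
    fix x
    have "\<bar>f x + g x\<bar> \<le> C * t ^ vec_total x + C' * t' ^ vec_total x"
      using *(3,6)[of x] by linarith
    also have "\<dots> \<le> C * max t t' ^ vec_total x + C' * max t t' ^ vec_total x"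
      using * by (intro add_mono mult_left_mono power_mono) auto
    finally show "\<bar>f x + g x\<bar> \<le> (C + C') * max t t' ^ vec_total x"
      by (simp add: algebra_simps)
  qed (use * in auto)
qed

lemma exp_bounded_cmult: "exp_bounded f \<Longrightarrow> exp_bounded (\<lambda>x. c * f x)"
  by (intro exp_bounded_mult exp_bounded_const)

lemma exp_bounded_sum: "(\<And>i. i \<in> A \<Longrightarrow> exp_bounded (f i)) \<Longrightarrow> exp_bounded (\<lambda>x. \<Sum>i\<in>A. f i x)"
  by (induction A rule: infinite_finite_induct) (auto intro: exp_bounded_const exp_bounded_add)

lemma exp_bounded_coord: "exp_bounded (\<lambda>x. real (x $ i))"
proof (rule exp_boundedI[of 1 2])
  fix x :: "nat ^ 'a"
  have "x $ i \<le> vec_total x" unfolding vec_total_def by (intro member_le_sum) auto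
  also have "\<dots> \<le> 2 ^ vec_total x" by (intro less_imp_le less_exp)
  finally have "real (x $ i) \<le> 2 ^ vec_total x" by (metis of_nat_le_iff of_nat_numeral of_nat_power)
  then show "\<bar>real (x $ i)\<bar> \<le> 1 * 2 ^ vec_total x" by simp
qed auto

lemma exp_bounded_minus:
  assumes "exp_bounded f"
  shows "exp_bounded (\<lambda>x. f (x - axis i 1))"
proof -
  from assms obtain C t where *: "C \<ge> 0" "t \<ge> 1" "\<And>x. \<bar>f x\<bar> \<le> C * t ^ vec_total x"
    unfolding exp_bounded_def by blast
  show ?thesis
  proof (rule exp_boundedI[OF *(1,2)])
    fix x :: "nat ^ 'a"
    have "vec_total (x - axis i 1) \<le> vec_total x"
      unfolding vec_total_def by (intro sum_mono) auto
    then have "C * t ^ vec_total (x - axis i 1) \<le> C * t ^ vec_total x"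
      using * by (intro mult_left_mono power_increasing) auto
    then show "\<bar>f (x - axis i 1)\<bar> \<le> C * t ^ vec_total x"
      using *(3)[of "x - axis i 1"] by linarith
  qed
qed

lemma exp_bounded_plus:
  assumes "exp_bounded f"
  shows "exp_bounded (\<lambda>x. f (x + axis i 1))"
proof -
  from assms obtain C t where *: "C \<ge> 0" "t \<ge> 1" "\<And>x. \<bar>f x\<bar> \<le> C * t ^ vec_total x"
    unfolding exp_bounded_def by blast
  show ?thesis
    by (rule exp_boundedI[of "C * t" t]) (use * *(3)[of "_ + axis i 1"] in \<open>auto simp: mult_ac power_add\<close>)
qed

lemma poisson_prod_pos: "(\<And>i. \<mu> $ i > 0) \<Longrightarrow> poisson_prod \<mu> x > 0"
  by (simp add: poisson_prod_def prod_pos)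

lemma poisson_prod_add:
  "poisson_prod \<mu> (x + axis i 1) * real (x $ i + 1) = \<mu> $ i * poisson_prod \<mu> x"
proof -
  have "poisson_prod \<mu> (x + axis i 1) = \<mu> $ i / real (x $ i + 1) * poisson_prod \<mu> x"
    unfolding poisson_prod_def by (rule prod_add_axis) (simp add: add_ac)
  then show ?thesis by (simp del: of_nat_add)
qed

text \<open>The probability generating function of |X|, a Poisson variable with mean |mu|. It makes
  geometric growth summable.\<close>

lemma poisson_prod_has_sum_power:
  assumes "\<And>i. \<mu> $ i > 0" "t \<ge> 0"
  shows "((\<lambda>x. poisson_prod \<mu> x * t ^ vec_total x) has_sum exp ((t - 1) * vec_total \<mu>)) UNIV"
proof -
  have "((\<lambda>k. exp (- \<mu> $ i) * ((t * \<mu> $ i) ^ k / fact k)) has_sum exp (- \<mu> $ i) * exp (t * \<mu> $ i)) UNIV" for i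
    by (intro has_sum_cmult_right exp_has_sum)
  then have "((\<lambda>x. \<Prod>i\<in>UNIV. exp (- \<mu> $ i) * ((t * \<mu> $ i) ^ (x $ i) / fact (x $ i)))
      has_sum (\<Prod>i\<in>UNIV. exp (- \<mu> $ i) * exp (t * \<mu> $ i))) UNIV"
    using assms by (intro has_sum_prod_vec) (auto simp: less_imp_le)
  moreover have "(\<Prod>i\<in>UNIV. exp (- \<mu> $ i) * exp (t * \<mu> $ i)) = exp ((t - 1) * vec_total \<mu>)"
    by (simp add: vec_total_def sum_distrib_left exp_sum algebra_simps flip: exp_add)
  moreover have "(\<Prod>i\<in>UNIV. exp (- \<mu> $ i) * ((t * \<mu> $ i) ^ (x $ i) / fact (x $ i)))
      = poisson_prod \<mu> x * t ^ vec_total x" for x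
    by (simp add: poisson_prod_def vec_total_def power_sum power_mult_distrib mult_ac flip: prod.distrib)
  ultimately show ?thesis by simp
qed

section \<open>Expectation under the Poisson law\<close>

context hypergroup_basis
begin

abbreviation P where "P \<equiv> poisson_prod \<mu>"

definition EP :: "(nat ^ 'd \<Rightarrow> real) \<Rightarrow> real" where
  "EP f = (\<Sum>\<^sub>\<infinity>x. P x * f x)"

lemma P_pos: "P x > 0"
  by (rule poisson_prod_pos) (rule mu_pos)

lemma P_has_sum: "(P has_sum 1) UNIV"
  using poisson_prod_has_sum_power[of \<mu> 1] mu_pos by simp

lemma P_summable:
  assumes "exp_bounded f"
  shows "(\<lambda>x. P x * f x) summable_on UNIV"
proof -
  from assms obtain C t where *: "C \<ge> 0" "t \<ge> 1" "\<And>x. \<bar>f x\<bar> \<le> C * t ^ vec_total x"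
    unfolding exp_bounded_def by blast
  have "(\<lambda>x. P x * t ^ vec_total x) summable_on UNIV"
    using poisson_prod_has_sum_power[of \<mu> t] mu_pos *(2) by (auto simp: summable_on_def)
  then have "(\<lambda>x. C * (P x * t ^ vec_total x)) summable_on UNIV"
    by (rule summable_on_cmult_right)
  then have "(\<lambda>x. norm (P x * f x)) summable_on UNIV"
    by (rule Infinite_Sum.abs_summable_on_comparison_test')
      (use mult_left_mono[OF *(3) less_imp_le[OF P_pos]] P_pos in \<open>simp add: abs_mult abs_of_pos mult.left_commute[of C]\<close>)
  then show ?thesis by (rule summable_on_iff_abs_summable_on_real[THEN iffD2])
qed

lemma EP_add: "exp_bounded f \<Longrightarrow> exp_bounded g \<Longrightarrow> EP (\<lambda>x. f x + g x) = EP f + EP g"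
  unfolding EP_def by (simp add: distrib_left infsum_add P_summable)

lemma EP_cmult: "EP (\<lambda>x. c * f x) = c * EP f"
  unfolding EP_def by (simp add: mult.left_commute infsum_cmult_right')

lemma EP_sum: "(\<And>i. i \<in> A \<Longrightarrow> exp_bounded (f i)) \<Longrightarrow> EP (\<lambda>x. \<Sum>i\<in>A. f i x) = (\<Sum>i\<in>A. EP (f i))"
proof (induction A rule: infinite_finite_induct)
  case (insert i A)
  then show ?case by (simp add: EP_add exp_bounded_sum)
qed (simp_all add: EP_def)

text \<open>The Chen-Stein identity, from x_i P(x) = mu_i P(x - e_i) and the substitution of x + e_i
  for x. Terms with x_i = 0 vanish, so truncation is harmless.\<close>

lemma EP_shift: "EP (\<lambda>x. real (x $ i) * f (x - axis i 1)) = \<mu> $ i * EP f"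
proof -
  have "bij_betw (\<lambda>x :: nat ^ 'd. x + axis i 1) UNIV {x. x $ i \<noteq> 0}"
    by (rule bij_betwI[of _ _ _ "\<lambda>x. x - axis i 1"]) (auto simp: axis_le_cancel)
  then have "(\<Sum>\<^sub>\<infinity>x\<in>{x. x $ i \<noteq> 0}. P x * (real (x $ i) * f (x - axis i 1)))
      = (\<Sum>\<^sub>\<infinity>x. P (x + axis i 1) * (real ((x + axis i 1) $ i) * f (x + axis i 1 - axis i 1)))"
    by (rule infsum_reindex_bij_betw[symmetric])
  also have "\<dots> = (\<Sum>\<^sub>\<infinity>x. \<mu> $ i * (P x * f x))"
    using poisson_prod_add[of \<mu> _ i] by (intro infsum_cong) (simp add: mult.assoc[symmetric])
  finally have "(\<Sum>\<^sub>\<infinity>x\<in>{x. x $ i \<noteq> 0}. P x * (real (x $ i) * f (x - axis i 1))) = \<mu> $ i * EP f"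
    by (simp add: EP_def infsum_cmult_right')
  moreover have "(\<Sum>\<^sub>\<infinity>x\<in>{x. x $ i \<noteq> 0}. P x * (real (x $ i) * f (x - axis i 1)))
      = EP (\<lambda>x. real (x $ i) * f (x - axis i 1))"
    unfolding EP_def by (intro infsum_cong_neutral) auto
  ultimately show ?thesis by simp
qed

lemma exp_bounded_D: "exp_bounded (D n)"
proof (rule exp_boundedI[of "1 / vfact n" "exp (vec_total n / M)"])
  fix x :: "nat ^ 'd"
  have "(1 + real (vec_total x) / M) ^ vec_total n \<le> exp (real (vec_total x) / M) ^ vec_total n"
    using M_pos by (intro power_mono exp_ge_add_one_self) auto
  also have "\<dots> = exp (real (vec_total n) / M) ^ vec_total x"
    by (simp add: mult.commute flip: exp_of_nat_mult)
  finally have "(1 + vec_total x / M) ^ vec_total n / vfact n \<le> exp (vec_total n / M) ^ vec_total x / vfact n"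
    by (intro divide_right_mono) (auto simp: less_imp_le)
  with D_bound[of n x] show "\<bar>D n x\<bar> \<le> 1 / vfact n * exp (vec_total n / M) ^ vec_total x"
    by simp
qed (use M_pos in \<open>auto simp: less_imp_le\<close>)

lemmas exp_bounded_intros = exp_bounded_const exp_bounded_cmult exp_bounded_sum exp_bounded_coord
  exp_bounded_add exp_bounded_mult exp_bounded_minus exp_bounded_plus exp_bounded_D

text \<open>\<open>D_lower\<close> produces x_i D_n(x - e_i) D_m(x), which \<open>EP_shift\<close>
  turns into D_n(x) D_m(x + e_i), and \<open>D_step\<close> expands this. After weighting with
  u^(j)_i p_i, orthogonality of the basis keeps only the shift in direction j, and the unshifted
  part cancels the correction term for j = \<open>l0\<close>.\<close>

lemma EP_D_lower:
  "(real (n $ j) + 1) * EP (\<lambda>x. D (n + axis j 1) x * D m x)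
    = a j / M * vshift j (\<lambda>m. EP (\<lambda>x. D n x * D m x)) m"
proof -
  define e :: real where "e = (if j = l0 then 1 else 0)"
  have sp: "(\<Sum>i\<in>UNIV. u j $ i * p i) = e" by (simp add: sum_up e_def)
  have ex: "exp_bounded (\<lambda>x. real (x $ i) * (D n (x - axis i 1) * D m x))" for i
    by (intro exp_bounded_intros)
  have shift: "EP (\<lambda>x. real (x $ i) * (D n (x - axis i 1) * D m x)) = \<mu> $ i * EP (\<lambda>x. D n x * D m (x + axis i 1))" for i
  proof -
    have "EP (\<lambda>x. real (x $ i) * (D n (x - axis i 1) * D m x))
        = EP (\<lambda>x. real (x $ i) * (\<lambda>x. D n x * D m (x + axis i 1)) (x - axis i 1))"
    proof (rule arg_cong[where f = EP], rule ext)
      fix x :: "nat ^ 'd"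
      show "real (x $ i) * (D n (x - axis i 1) * D m x)
          = real (x $ i) * (\<lambda>x. D n x * D m (x + axis i 1)) (x - axis i 1)"
        by (cases "x $ i = 0") (simp_all add: axis_le_cancel)
    qed
    also have "\<dots> = \<mu> $ i * EP (\<lambda>x. D n x * D m (x + axis i 1))" by (rule EP_shift)
    finally show ?thesis .
  qed
  have step: "EP (\<lambda>x. D n x * D m (x + axis i 1)) = EP (\<lambda>x. D n x * D m x)
      + (\<Sum>k\<in>UNIV. u k $ i / M * vshift k (\<lambda>m. EP (\<lambda>x. D n x * D m x)) m)" for i
  proof -
    have v: "EP (\<lambda>x. D n x * vshift k (\<lambda>m. D m x) m) = vshift k (\<lambda>m. EP (\<lambda>x. D n x * D m x)) m" for k
      by (simp add: vshift_def EP_def)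
    have ev: "exp_bounded (\<lambda>x. vshift k (\<lambda>m. D m x) m)" for k
      by (cases "m $ k = 0") (auto simp: vshift_def intro: exp_bounded_intros)
    have "EP (\<lambda>x. D n x * D m (x + axis i 1)) = EP (\<lambda>x. D n x * D m x
        + (\<Sum>k\<in>UNIV. u k $ i / M * (D n x * vshift k (\<lambda>m. D m x) m)))"
      by (simp add: D_step algebra_simps sum_distrib_left)
    also have "\<dots> = EP (\<lambda>x. D n x * D m x) + (\<Sum>k\<in>UNIV. EP (\<lambda>x. u k $ i / M * (D n x * vshift k (\<lambda>m. D m x) m)))"
      by (subst EP_add, intro exp_bounded_intros, intro exp_bounded_intros ev, subst EP_sum)
        (intro exp_bounded_intros ev, rule refl)
    finally show ?thesis by (simp only: EP_cmult v)
  qed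
  have "(real (n $ j) + 1) * EP (\<lambda>x. D (n + axis j 1) x * D m x)
      = EP (\<lambda>x. (\<Sum>i\<in>UNIV. u j $ i / M * (real (x $ i) * (D n (x - axis i 1) * D m x))) + (- e) * (D n x * D m x))"
  proof -
    have "(real (n $ j) + 1) * (D (n + axis j 1) x * D m x)
        = (\<Sum>i\<in>UNIV. u j $ i / M * (real (x $ i) * (D n (x - axis i 1) * D m x))) + (- e) * (D n x * D m x)" for x
      unfolding mult.assoc[symmetric] D_lower by (simp add: algebra_simps sum_distrib_left e_def)
    then show ?thesis by (simp flip: EP_cmult)
  qed
  also have "\<dots> = (\<Sum>i\<in>UNIV. EP (\<lambda>x. u j $ i / M * (real (x $ i) * (D n (x - axis i 1) * D m x))))
      + EP (\<lambda>x. (- e) * (D n x * D m x))"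
    by (subst EP_add, intro exp_bounded_intros ex, intro exp_bounded_intros, subst EP_sum)
      (intro exp_bounded_intros ex, rule refl)
  also have "\<dots> = (\<Sum>i\<in>UNIV. u j $ i * p i * EP (\<lambda>x. D n x * D m (x + axis i 1))) - e * EP (\<lambda>x. D n x * D m x)"
    using M_pos by (simp only: EP_cmult shift) (simp add: mu_eq mult_ac)
  also have "(\<Sum>i\<in>UNIV. u j $ i * p i * EP (\<lambda>x. D n x * D m (x + axis i 1)))
      = (\<Sum>i\<in>UNIV. u j $ i * p i) * EP (\<lambda>x. D n x * D m x)
        + (\<Sum>k\<in>UNIV. (\<Sum>i\<in>UNIV. u j $ i * u k $ i * p i) * (vshift k (\<lambda>m. EP (\<lambda>x. D n x * D m x)) m / M))"
    unfolding step distrib_left sum.distrib sum_distrib_left sum_distrib_right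
    by (subst (2) sum.swap) (simp add: mult_ac)
  also have "(\<Sum>k\<in>UNIV. (\<Sum>i\<in>UNIV. u j $ i * u k $ i * p i) * (vshift k (\<lambda>m. EP (\<lambda>x. D n x * D m x)) m / M))
      = a j * (vshift j (\<lambda>m. EP (\<lambda>x. D n x * D m x)) m / M)"
    by (simp add: u_orth if_distrib[of "\<lambda>c. c * _"] cong: if_cong flip: sum_divide_distrib)
  finally show ?thesis by (simp add: sp)
qed

abbreviation h where "h \<equiv> charlier_h \<mu> a"

lemma h_0 [simp]: "h 0 = 1"
  by (simp add: charlier_h_def)

lemma h_pos: "h n > 0"
  using M_pos by (auto simp: charlier_h_def M_def a_pos intro!: mult_pos_pos prod_pos)

lemma h_add: "h (n + axis j 1) = M * (real (n $ j) + 1) / a j * h n"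
proof -
  have "(\<Prod>i\<in>UNIV. fact ((n + axis j 1) $ i) / a i ^ ((n + axis j 1) $ i))
      = (real (n $ j) + 1) / a j * (\<Prod>i\<in>UNIV. fact (n $ i) / a i ^ (n $ i))"
    by (rule prod_add_axis) (simp add: add_ac)
  then show ?thesis by (simp add: charlier_h_def M_def power_add)
qed

text \<open>By \<open>EP_D_lower\<close> a unit of degree is removed from both indices at once, and
  \<open>h_add\<close> supplies the matching factor of the norm.\<close>

lemma EP_D_orth: "EP (\<lambda>x. D n x * D m x) = (if n = m then 1 / h n else 0)"
proof (induction n arbitrary: m rule: vec_nat_induct)
  case zero
  \<comment> \<open>The lowering is applied to the other index here: for m nonzero it shifts the
    index 0, which gives 0.\<close>
  have "EP (\<lambda>x. D m x * D 0 x) = (if m = 0 then 1 else 0)"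
  proof (cases "m = 0")
    case True
    then show ?thesis using P_has_sum by (simp add: EP_def infsumI)
  next
    case False
    then obtain j where "m $ j \<noteq> 0" by (auto simp: vec_eq_iff)
    then obtain n where m: "m = n + axis j 1" using axis_le_cancel by metis
    have "(real (n $ j) + 1) * EP (\<lambda>x. D m x * D 0 x) = 0"
      unfolding m EP_D_lower by (simp add: vshift_def)
    moreover have "real (n $ j) + 1 \<noteq> 0" by linarith
    ultimately show ?thesis using False by simp
  qed
  then show ?case by (simp add: mult.commute)
next
  case (add n j)
  have nz: "real (n $ j) + 1 \<noteq> 0" by linarith
  have *: "(real (n $ j) + 1) * EP (\<lambda>x. D (n + axis j 1) x * D m x)
      = a j / M * vshift j (\<lambda>m. if n = m then 1 / h n else 0) m"
    unfolding EP_D_lower add.IH ..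
  show ?case
  proof (cases "m $ j = 0")
    case True
    then have "n + axis j 1 \<noteq> m" by auto
    with * True nz show ?thesis by (simp add: vshift_def)
  next
    case False
    then obtain m' where m: "m = m' + axis j 1" using axis_le_cancel by metis
    have "(real (n $ j) + 1) * EP (\<lambda>x. D (n + axis j 1) x * D m x) = a j / M * (if n = m' then 1 / h n else 0)"
      using * by (simp add: m)
    then have "EP (\<lambda>x. D (n + axis j 1) x * D m x) = a j / M * (if n = m' then 1 / h n else 0) / (real (n $ j) + 1)"
      unfolding mult.commute[of "real (n $ j) + 1"] by (rule nonzero_eq_divide_eq[OF nz, THEN iffD2])
    moreover have "n + axis j 1 = m' + axis j 1 \<longleftrightarrow> n = m'" by simp
    ultimately show ?thesis
      by (simp add: m h_add)
  qed
qed

end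

section \<open>The kernel of the expansion\<close>

lemma has_sum_finite_sum:
  fixes f :: "'i \<Rightarrow> 'a \<Rightarrow> real"
  assumes "\<And>i. i \<in> I \<Longrightarrow> (f i has_sum S i) A"
  shows "((\<lambda>x. \<Sum>i\<in>I. f i x) has_sum (\<Sum>i\<in>I. S i)) A"
  using assms by (induction I rule: infinite_finite_induct) (auto intro: has_sum_add has_sum_0)

lemma power_vec_total: "c ^ vec_total (n :: nat ^ 'd) = (\<Prod>j\<in>UNIV. c ^ (n $ j))"
  by (simp add: vec_total_def power_sum)

lemma has_sum_diff:
  fixes f g :: "'a \<Rightarrow> real"
  assumes "(f has_sum S) A" "(g has_sum T) A"
  shows "((\<lambda>x. f x - g x) has_sum (S - T)) A"
  using has_sum_add[OF assms(1) has_sum_uminusI[OF assms(2)]] by simp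

lemma has_sum_fubini:
  fixes f :: "'a \<Rightarrow> 'b \<Rightarrow> real"
  assumes "(\<lambda>(x, y). f x y) summable_on UNIV"
    and "\<And>y. ((\<lambda>x. f x y) has_sum g y) UNIV" and "(g has_sum S) UNIV"
    and "\<And>x. ((\<lambda>y. f x y) has_sum k x) UNIV"
  shows "((\<lambda>(x, y). f x y) has_sum S) UNIV" and "(k has_sum S) UNIV"
proof -
  have s: "(\<lambda>(x, y). f x y) summable_on UNIV \<times> UNIV" using assms(1) by simp
  have "((\<lambda>(y, x). f x y) has_sum S) (UNIV \<times> UNIV)"
  proof (rule has_sum_SigmaI)
    show "(\<lambda>(y, x). f x y) summable_on UNIV \<times> UNIV"
      using s by (subst summable_on_swap) (simp add: case_prod_unfold)
  qed (use assms in auto)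
  then have *: "((\<lambda>(x, y). f x y) has_sum S) (UNIV \<times> UNIV)"
    by (subst has_sum_swap) (simp add: case_prod_unfold)
  then show "((\<lambda>(x, y). f x y) has_sum S) UNIV" by simp
  show "(k has_sum S) UNIV"
    by (rule has_sum_Sigma'[OF *]) (use assms(4) in auto)
qed

lemma summable_on_product_real:
  fixes f :: "'a \<Rightarrow> 'b \<Rightarrow> real"
  assumes "\<And>x. ((\<lambda>y. \<bar>f x y\<bar>) has_sum g x) UNIV" and "g summable_on UNIV"
  shows "(\<lambda>(x, y). f x y) summable_on UNIV"
proof -
  have "(\<lambda>z. \<bar>case z of (x, y) \<Rightarrow> f x y\<bar>) summable_on (UNIV \<times> UNIV)"
    by (rule summable_on_SigmaI[where g = g]) (use assms in auto)
  then show ?thesis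
    by (subst summable_on_iff_abs_summable_on_real) simp
qed

context hypergroup_basis
begin

definition DD :: "nat ^ 'd \<Rightarrow> nat ^ 'd \<Rightarrow> nat ^ 'd \<Rightarrow> real" where
  "DD x y n = h n * D n x * D n y"

text \<open>The kernel K of the overview for an arbitrary coefficient family; the constant term n =
  0 is part of the sum.\<close>

definition F :: "(nat ^ 'd \<Rightarrow> real) \<Rightarrow> nat ^ 'd \<Rightarrow> nat ^ 'd \<Rightarrow> real" where
  "F r x y = (\<Sum>\<^sub>\<infinity>n. r n * DD x y n)"

lemma F_commute: "F r x y = F r y x"
  by (simp add: F_def DD_def mult_ac)

definition A :: "nat ^ 'd \<Rightarrow> real" where
  "A x = 1 + vec_total x / M"

definition \<kappa> :: real where "\<kappa> = (\<Sum>j\<in>UNIV. M / a j)"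

lemma A_ge_1: "A x \<ge> 1"
  using M_pos by (simp add: A_def)

lemma \<kappa>_nonneg: "\<kappa> \<ge> 0"
  unfolding \<kappa>_def using M_pos by (intro sum_nonneg) (simp add: a_pos less_imp_le)

text \<open>The norm \<open>h n\<close> contributes M^|n| n!/a^n and the two polynomials at most
  A^|n|/n! each. What remains is a product of exponential series, and \<kappa> collects their rates
  M/a_j.\<close>

lemma DD_bound:
  obtains b where "(b has_sum exp (\<kappa> * A x * A y)) UNIV" "\<And>n. \<bar>DD x y n\<bar> \<le> b n"
proof
  define t where "t j = M / a j * (A x * A y)" for j
  have t: "t j \<ge> 0" for j
    using M_pos A_ge_1[of x] A_ge_1[of y] by (simp add: t_def a_pos less_imp_le)
  have "((\<lambda>n. \<Prod>j\<in>UNIV. t j ^ (n $ j) / fact (n $ j)) has_sum (\<Prod>j\<in>UNIV. exp (t j))) UNIV"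
    using t by (intro has_sum_prod_vec exp_has_sum) auto
  moreover have "(\<Sum>j\<in>UNIV. t j) = \<kappa> * A x * A y"
    by (simp only: t_def \<kappa>_def sum_distrib_right mult.assoc)
  then have "(\<Prod>j\<in>UNIV. exp (t j)) = exp (\<kappa> * A x * A y)"
    by (simp flip: exp_sum)
  ultimately show "((\<lambda>n. \<Prod>j\<in>UNIV. t j ^ (n $ j) / fact (n $ j)) has_sum exp (\<kappa> * A x * A y)) UNIV"
    by simp
  fix n
  have "\<bar>DD x y n\<bar> = h n * (\<bar>D n x\<bar> * \<bar>D n y\<bar>)"
    using h_pos[of n] by (simp add: DD_def abs_mult)
  also have "\<dots> \<le> h n * ((A x ^ vec_total n / vfact n) * (A y ^ vec_total n / vfact n))"
    using h_pos[of n] D_bound[of n] A_ge_1[of x] by (intro mult_left_mono mult_mono) (auto simp: A_def less_imp_le)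
  also have "\<dots> = (\<Prod>j\<in>UNIV. M ^ (n $ j) * (fact (n $ j) / a j ^ (n $ j)) *
      (A x ^ (n $ j) / fact (n $ j) * (A y ^ (n $ j) / fact (n $ j))))"
    by (simp add: charlier_h_def M_def[symmetric] vfact_def power_vec_total prod.distrib prod_dividef mult_ac)
  also have "\<dots> = (\<Prod>j\<in>UNIV. t j ^ (n $ j) / fact (n $ j))"
    by (intro prod.cong) (auto simp: t_def power_mult_distrib power_divide)
  finally show "\<bar>DD x y n\<bar> \<le> \<dots>" .
qed

lemma DD_summable: "(\<lambda>n. \<bar>DD x y n\<bar>) summable_on UNIV"
  and DD_infsum_le: "(\<Sum>\<^sub>\<infinity>n. \<bar>DD x y n\<bar>) \<le> exp (\<kappa> * A x * A y)"
proof -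
  obtain b where b: "(b has_sum exp (\<kappa> * A x * A y)) UNIV" "\<And>n. \<bar>DD x y n\<bar> \<le> b n"
    using DD_bound[of x y] by blast
  show s: "(\<lambda>n. \<bar>DD x y n\<bar>) summable_on UNIV"
    by (rule summable_on_comparison_test[of b]) (use b in \<open>auto simp: summable_on_def\<close>)
  show "(\<Sum>\<^sub>\<infinity>n. \<bar>DD x y n\<bar>) \<le> exp (\<kappa> * A x * A y)"
    by (rule has_sum_mono[OF has_sum_infsum[OF s] b(1) b(2)])
qed

lemma rDD_abs_summable:
  assumes "\<And>n. \<bar>r n\<bar> \<le> 1"
  shows "(\<lambda>n. \<bar>r n * DD x y n\<bar>) summable_on UNIV"
  by (rule summable_on_comparison_test[OF DD_summable])
    (use mult_right_mono[OF assms abs_ge_zero] in \<open>auto simp: abs_mult\<close>)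

lemma F_has_sum:
  assumes "\<And>n. \<bar>r n\<bar> \<le> 1"
  shows "((\<lambda>n. r n * DD x y n) has_sum F r x y) UNIV"
  unfolding F_def using rDD_abs_summable[of r x y, OF assms]
  by (intro has_sum_infsum, subst summable_on_iff_abs_summable_on_real) simp

lemma rDD_infsum_le:
  assumes "\<And>n. \<bar>r n\<bar> \<le> 1"
  shows "(\<Sum>\<^sub>\<infinity>n. \<bar>r n * DD x y n\<bar>) \<le> exp (\<kappa> * A x * A y)"
proof -
  have "(\<Sum>\<^sub>\<infinity>n. \<bar>r n * DD x y n\<bar>) \<le> (\<Sum>\<^sub>\<infinity>n. \<bar>DD x y n\<bar>)"
    using mult_right_mono[OF assms abs_ge_zero]
    by (intro infsum_mono rDD_abs_summable assms DD_summable) (auto simp: abs_mult)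
  then show ?thesis using DD_infsum_le[of x y] by linarith
qed

lemma exp_bounded_exp_A: "exp_bounded (\<lambda>x. exp (\<kappa> * A x * A y))"
proof (rule exp_boundedI[of "exp (\<kappa> * A y)" "exp (\<kappa> * A y / M)"])
  fix x :: "nat ^ 'd"
  have "exp (\<kappa> * A x * A y) = exp (\<kappa> * A y) * exp (vec_total x * (\<kappa> * A y / M))"
    by (simp add: A_def[of x] algebra_simps add_divide_distrib flip: exp_add)
  also have "exp (vec_total x * (\<kappa> * A y / M)) = exp (\<kappa> * A y / M) ^ vec_total x"
    by (rule exp_of_nat_mult)
  finally show "\<bar>exp (\<kappa> * A x * A y)\<bar> \<le> exp (\<kappa> * A y) * exp (\<kappa> * A y / M) ^ vec_total x"
    by simp
qed (use M_pos \<kappa>_nonneg A_ge_1[of y] in \<open>auto intro!: divide_nonneg_pos mult_nonneg_nonneg\<close>)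

text \<open>Termwise expectation against \<open>D m\<close> keeps only n = m. The exchange is
  legitimate since the sum of absolute values is at most exp(\<kappa> A(x) A(y)), which for fixed y
  grows geometrically in |x|.\<close>

lemma F_eigen:
  assumes r: "\<And>n. \<bar>r n\<bar> \<le> 1"
  shows "((\<lambda>x. P x * F r x y * D m x) has_sum (r m * D m y)) UNIV"
proof (rule has_sum_fubini(2)[where f = "\<lambda>x n. P x * D m x * (r n * DD x y n)"])
  define B where "B x = (\<Sum>\<^sub>\<infinity>n. \<bar>r n * DD x y n\<bar>)" for x
  have B1: "B x \<le> exp (\<kappa> * A x * A y)" for x
    unfolding B_def by (rule rDD_infsum_le[of r, OF r])
  have B0: "B x \<ge> 0" for x unfolding B_def by (intro infsum_nonneg) auto
  have "exp_bounded (\<lambda>x. \<bar>D m x\<bar> * exp (\<kappa> * A x * A y))"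
    by (intro exp_bounded_mult exp_bounded_exp_A) (use exp_bounded_D[of m] in \<open>simp add: exp_bounded_def\<close>)
  from P_summable[OF this] have "(\<lambda>x. \<bar>P x * D m x\<bar> * B x) summable_on UNIV"
    by (rule summable_on_comparison_test)
      (use B0 B1 P_pos in \<open>simp_all add: abs_mult mult.assoc less_imp_le mult_left_mono\<close>)
  then show "(\<lambda>(x, n). P x * D m x * (r n * DD x y n)) summable_on UNIV"
    by (rule summable_on_product_real[rotated])
      (simp only: abs_mult[of "P _ * D m _"] B_def, intro has_sum_cmult_right has_sum_infsum rDD_abs_summable r)
  show "((\<lambda>n. P x * D m x * (r n * DD x y n)) has_sum P x * F r x y * D m x) UNIV" for x
    using has_sum_cmult_right[OF F_has_sum[of r x y, OF r], of "P x * D m x"] by (simp add: mult_ac)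
  show "((\<lambda>x. P x * D m x * (r n * DD x y n)) has_sum (if n = m then r m * D m y else 0)) UNIV" for n
  proof -
    have "((\<lambda>x. P x * (D m x * D n x)) has_sum (if n = m then 1 / h n else 0)) UNIV"
      using EP_D_orth[of m n] has_sum_infsum[OF P_summable, of "\<lambda>x. D m x * D n x"]
      by (auto simp: EP_def exp_bounded_mult exp_bounded_D split: if_splits)
    from has_sum_cmult_right[OF this, of "r n * h n * D n y"] show ?thesis
      using h_pos[of n] by (auto simp: DD_def mult_ac split: if_splits)
  qed
  show "((\<lambda>n. if n = m then r m * D m y else 0) has_sum r m * D m y) UNIV"
    by (rule has_sum_finite_neutralI[of "{m}"]) auto
qed

section \<open>Product coefficients and positivity for a fixed point of the simplex\<close>

definition monp :: "('d \<Rightarrow> real) \<Rightarrow> nat ^ 'd \<Rightarrow> real" where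
  "monp c n = (\<Prod>j\<in>UNIV. c j ^ (n $ j))"

lemma monp_add: "monp c (n + axis j 1) = c j * monp c n"
  unfolding monp_def by (rule prod_add_axis) simp

lemma monp_0 [simp]: "monp c 0 = 1"
  by (simp add: monp_def)

lemma monp_le_1: "(\<And>j. \<bar>c j\<bar> \<le> 1) \<Longrightarrow> \<bar>monp c n\<bar> \<le> 1"
  unfolding monp_def abs_prod by (intro prod_le_1) (auto simp: power_abs power_le_one)

text \<open>\<open>D_step\<close> in x lowers the degree of one factor only; re-indexing the series
  by n + e_j moves the mismatch to D_{n+e_j}(y). There \<open>h_add\<close> provides exactly the
  factor n_j + 1 that \<open>D_lower\<close> consumes, and a product family pays for the re-indexing
  with the scalar c_j.\<close>

lemma F_monp_step:
  assumes c: "\<And>j. \<bar>c j\<bar> \<le> 1"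
  shows "F (monp c) (x + axis i 1) y = (1 - c l0) * F (monp c) x y
    + (\<Sum>k\<in>UNIV. y $ k / M * (\<Sum>j\<in>UNIV. u j $ i * u j $ k * c j / a j) * F (monp c) x (y - axis k 1))"
proof -
  let ?r = "monp c"
  have Fs: "((\<lambda>n. ?r n * DD x z n) has_sum F ?r x z) UNIV" for z
    by (intro F_has_sum monp_le_1 c)
  define T where "T j = c j / a j * (\<Sum>k\<in>UNIV. y $ k * u j $ k * F ?r x (y - axis k 1))
      - (if j = l0 then M * c l0 * F ?r x y else 0)" for j
  have T: "((\<lambda>n. ?r n * h n * vshift j (\<lambda>n. D n x) n * D n y) has_sum T j) UNIV" for j
  proof -
    have "((\<lambda>n. c j * M / a j * (\<Sum>k\<in>UNIV. y $ k * u j $ k / M * (?r n * DD x (y - axis k 1) n))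
          - (if j = l0 then M * c j * (?r n * DD x y n) else 0))
        has_sum (c j * M / a j * (\<Sum>k\<in>UNIV. y $ k * u j $ k / M * F ?r x (y - axis k 1))
          - (if j = l0 then M * c j * F ?r x y else 0))) UNIV"
      by (intro has_sum_diff has_sum_cmult_right has_sum_finite_sum Fs)
        (auto intro: has_sum_cmult_right[OF Fs])
    also have "c j * M / a j * (\<Sum>k\<in>UNIV. y $ k * u j $ k / M * F ?r x (y - axis k 1))
          - (if j = l0 then M * c j * F ?r x y else 0) = T j"
      using M_pos by (simp add: T_def sum_distrib_left mult_ac)
    also have "(\<lambda>n. c j * M / a j * (\<Sum>k\<in>UNIV. y $ k * u j $ k / M * (?r n * DD x (y - axis k 1) n))
          - (if j = l0 then M * c j * (?r n * DD x y n) else 0))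
        = (\<lambda>n. ?r (n + axis j 1) * h (n + axis j 1) * vshift j (\<lambda>n. D n x) (n + axis j 1) * D (n + axis j 1) y)"
    proof
      fix n
      have "?r (n + axis j 1) * h (n + axis j 1) * vshift j (\<lambda>n. D n x) (n + axis j 1) * D (n + axis j 1) y
          = c j * M / a j * ?r n * h n * D n x * ((real (n $ j) + 1) * D (n + axis j 1) y)"
        by (simp add: monp_add h_add)
      also have "\<dots> = c j * M / a j * (\<Sum>k\<in>UNIV. y $ k * u j $ k / M * (?r n * DD x (y - axis k 1) n))
          - (if j = l0 then M * c j * (?r n * DD x y n) else 0)"
        unfolding D_lower using M_pos by (cases "j = l0") (simp_all add: right_diff_distrib sum_distrib_left DD_def mult_ac)
      finally show "c j * M / a j * (\<Sum>k\<in>UNIV. y $ k * u j $ k / M * (?r n * DD x (y - axis k 1) n))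
          - (if j = l0 then M * c j * (?r n * DD x y n) else 0)
        = ?r (n + axis j 1) * h (n + axis j 1) * vshift j (\<lambda>n. D n x) (n + axis j 1) * D (n + axis j 1) y"
        by simp
    qed
    \<comment> \<open>The shift vanishes where n_j = 0, so the series lives on the image of n -> n +
      e_j.\<close>
    finally have "((\<lambda>n. ?r n * h n * vshift j (\<lambda>n. D n x) n * D n y) has_sum T j) {n. n $ j \<noteq> 0}"
      by (subst has_sum_reindex_bij_betw[of "\<lambda>n. n + axis j 1" UNIV, symmetric])
        (auto simp: axis_le_cancel intro!: bij_betwI[of _ _ _ "\<lambda>x. x - axis j 1"])
    then show ?thesis
      by (subst has_sum_cong_neutral[of "{n. n $ j \<noteq> 0}"]) (auto simp: vshift_def)
  qed
  have "((\<lambda>n. ?r n * DD x y n + (\<Sum>j\<in>UNIV. u j $ i / M * (?r n * h n * vshift j (\<lambda>n. D n x) n * D n y)))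
      has_sum (F ?r x y + (\<Sum>j\<in>UNIV. u j $ i / M * T j))) UNIV"
    by (intro has_sum_add Fs has_sum_finite_sum has_sum_cmult_right T)
  also have "(\<lambda>n. ?r n * DD x y n + (\<Sum>j\<in>UNIV. u j $ i / M * (?r n * h n * vshift j (\<lambda>n. D n x) n * D n y)))
      = (\<lambda>n. ?r n * DD (x + axis i 1) y n)"
    by (auto simp: DD_def D_step algebra_simps sum_distrib_left)
  finally have "F ?r (x + axis i 1) y = F ?r x y + (\<Sum>j\<in>UNIV. u j $ i / M * T j)"
    unfolding F_def by (rule infsumI)
  also have "(\<Sum>j\<in>UNIV. u j $ i / M * T j)
      = (\<Sum>j\<in>UNIV. \<Sum>k\<in>UNIV. y $ k / M * (u j $ i * u j $ k * c j / a j) * F ?r x (y - axis k 1))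
        - c l0 * F ?r x y"
  proof -
    have "u j $ i / M * T j = (\<Sum>k\<in>UNIV. y $ k / M * (u j $ i * u j $ k * c j / a j) * F ?r x (y - axis k 1))
        - (if j = l0 then c l0 * F ?r x y else 0)" for j
      using M_pos by (simp add: T_def right_diff_distrib sum_distrib_left mult_ac)
    then show ?thesis by (simp add: sum_subtractf)
  qed
  also have "(\<Sum>j\<in>UNIV. \<Sum>k\<in>UNIV. y $ k / M * (u j $ i * u j $ k * c j / a j) * F ?r x (y - axis k 1))
      = (\<Sum>k\<in>UNIV. y $ k / M * (\<Sum>j\<in>UNIV. u j $ i * u j $ k * c j / a j) * F ?r x (y - axis k 1))"
    by (subst sum.swap) (simp add: sum_distrib_left sum_distrib_right)
  finally show ?thesis by (simp add: algebra_simps)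
qed

definition lin :: "real ^ 'd \<Rightarrow> 'd \<Rightarrow> real" where
  "lin \<xi> j = (\<Sum>i\<in>UNIV. u j $ i * \<xi> $ i)"

lemma lin_l0: "lin \<xi> l0 = vec_total \<xi>"
  by (simp add: lin_def vec_total_def)

lemma lin_abs_le: "(\<And>i. \<xi> $ i \<ge> 0) \<Longrightarrow> \<bar>lin \<xi> j\<bar> \<le> vec_total \<xi>"
  unfolding lin_def vec_total_def
  by (intro order_trans[OF sum_abs] sum_mono)
    (auto simp: abs_mult intro: mult_right_mono[OF u_abs_le_1, of "\<xi> $ _", simplified])

lemma F_lin_nonneg:
  assumes "\<xi> \<in> unit_simplex"
  shows "F (monp (lin \<xi>)) x y \<ge> 0"
proof -
  let ?r = "monp (lin \<xi>)"
  have \<xi>: "\<xi> $ i \<ge> 0" and tot: "vec_total \<xi> \<le> 1" for i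
    using assms by (auto simp: unit_simplex_def)
  have le: "\<bar>lin \<xi> j\<bar> \<le> 1" for j
    using lin_abs_le[OF \<xi>, of j] tot by linarith
  have kernel: "(\<Sum>j\<in>UNIV. u j $ i * u j $ k * lin \<xi> j / a j) \<ge> 0" for i k
  proof -
    have "(\<Sum>j\<in>UNIV. u j $ i * u j $ k * lin \<xi> j / a j) = (\<Sum>l\<in>UNIV. \<xi> $ l * s i k l)"
      unfolding lin_def hypergroup_kernel_def sum_distrib_left sum_divide_distrib
      by (subst sum.swap) (simp add: divide_inverse mult_ac)
    also have "\<dots> \<ge> 0" by (intro sum_nonneg mult_nonneg_nonneg \<xi> kernel_nonneg)
    finally show ?thesis .
  qed
  \<comment> \<open>D_n(0) is nonzero only for n a multiple of e_{l0}, and there the term is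
    |xi|^{n_0} h_n D_n(0)^2.\<close>
  have "F ?r 0 0 \<ge> 0"
    unfolding F_def
  proof (rule infsum_nonneg)
    fix n
    show "?r n * DD 0 0 n \<ge> 0"
    proof (cases "\<forall>j. j \<noteq> l0 \<longrightarrow> n $ j = 0")
      case True
      then have "?r n = lin \<xi> l0 ^ (n $ l0)"
        unfolding monp_def by (subst prod.remove[of _ l0]) auto
      also have "\<dots> \<ge> 0" using \<xi> by (auto simp: lin_l0 vec_total_def intro!: sum_nonneg zero_le_power)
      finally show ?thesis
        using h_pos[of n] by (simp add: DD_def mult.assoc)
    next
      case False
      then have "D n 0 = 0" by (simp only: D_0_right if_False)
      then show ?thesis by (simp add: DD_def)
    qed
  qed
  \<comment> \<open>With y = 0 the sum in the recurrence is empty and each step multiplies by 1 -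
    |xi|. Symmetry then yields the base x = 0 of the induction on x with y arbitrary.\<close>
  then have "F ?r z 0 \<ge> 0" for z
    using tot by (induction z rule: vec_nat_induct) (simp_all add: F_monp_step[OF le] lin_l0)
  then have "F ?r 0 z \<ge> 0" for z
    by (subst F_commute)
  then show ?thesis
  proof (induction x arbitrary: y rule: vec_nat_induct)
    case (add x i)
    show ?case
      unfolding F_monp_step[OF le] using tot M_pos add
      by (intro add_nonneg_nonneg sum_nonneg mult_nonneg_nonneg kernel) (auto simp: lin_l0)
  qed
qed

end

section \<open>Joint laws and mixtures\<close>

lemma has_sum_imp_integral_count_space:
  fixes f :: "'a \<Rightarrow> real"
  assumes "(f has_sum S) UNIV"
  shows "integrable (count_space UNIV) f" and "integral\<^sup>L (count_space UNIV) f = S"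
proof -
  have "f summable_on UNIV" using assms by (auto simp: summable_on_def)
  then have a: "Infinite_Set_Sum.abs_summable_on f UNIV"
    unfolding abs_summable_equivalent[symmetric]
    by (rule summable_on_iff_abs_summable_on_real[THEN iffD1])
  then show "integrable (count_space UNIV) f"
    by (simp add: Infinite_Set_Sum.abs_summable_on_def)
  show "integral\<^sup>L (count_space UNIV) f = S"
    using infsetsum_infsum[OF a] infsumI[OF assms] by (simp add: infsetsum_def)
qed

lemma has_sum_imp_pmf:
  fixes f :: "'a \<Rightarrow> real"
  assumes "\<And>x. f x \<ge> 0" and "(f has_sum 1) UNIV"
  obtains q where "\<And>x. pmf q x = f x"
proof
  have "(\<integral>\<^sup>+x. ennreal (f x) \<partial>count_space UNIV) = 1"
    using has_sum_imp_integral_count_space[OF assms(2)] assms(1) by (simp add: nn_integral_eq_integral)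
  then show "pmf (embed_pmf f) x = f x" for x
    using assms(1) by (intro pmf_embed_pmf) auto
qed

lemma pmf_expectation_has_sum:
  fixes g :: "'a \<Rightarrow> real"
  assumes "((\<lambda>x. pmf q x * g x) has_sum S) UNIV"
  shows "integrable (measure_pmf q) g" and "measure_pmf.expectation q g = S"
proof -
  note * = has_sum_imp_integral_count_space[OF assms]
  show "integrable (measure_pmf q) g"
    unfolding measure_pmf_eq_density using *(1) by (subst integrable_density) auto
  show "measure_pmf.expectation q g = S"
    unfolding measure_pmf_eq_density using *(2) by (subst integral_density) auto
qed

lemma pmf_map_has_sum:
  assumes "inj g" and "\<And>z. \<phi> z = x \<longleftrightarrow> z \<in> range g"
    and "((\<lambda>y. pmf q (g y)) has_sum S) UNIV"
  shows "pmf (map_pmf \<phi> q) x = S"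
proof -
  have "((\<lambda>z. pmf q z) has_sum S) (range g)"
    using assms(1,3) by (simp add: has_sum_reindex o_def)
  also have "?this \<longleftrightarrow> ((\<lambda>z. pmf q z * indicator (range g) z) has_sum S) UNIV"
    by (rule has_sum_cong_neutral) auto
  finally have "((\<lambda>z. pmf q z * indicator (range g) z) has_sum S) UNIV" .
  then have "measure_pmf.expectation q (indicator (range g)) = S"
    by (rule pmf_expectation_has_sum)
  moreover have "\<phi> -` {x} = range g"
    using assms(2) by auto
  ultimately show ?thesis by (simp add: pmf_map)
qed

context hypergroup_basis
begin

lemma charlier_D: "charlier l0 \<mu> u n x = (- 1) ^ (n $ l0) * D n x"
  by (simp add: D_def flip: power_mult_distrib mult.assoc)

lemma lancaster_term_DD: "lancaster_term l0 \<mu> u a r x y n = r n * DD x y n"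
proof -
  have "(- 1 :: real) ^ (n $ l0) * (- 1) ^ (n $ l0) = 1"
    by (simp flip: power_mult_distrib)
  then show ?thesis
    unfolding lancaster_term_def charlier_D DD_def by (simp add: mult_ac)
qed

definition Q :: "(nat ^ 'd \<Rightarrow> real) \<Rightarrow> nat ^ 'd \<Rightarrow> nat ^ 'd \<Rightarrow> real" where
  "Q r x y = P x * P y * F r x y"

lemma Q_commute: "Q r x y = Q r y x"
  by (simp add: Q_def F_commute[of r x y])

lemma pos_degrees: "{n :: nat ^ 'd. vec_total n \<ge> 1} = UNIV - {0}"
  using vec_total_eq_0_iff by (auto simp: Suc_le_eq simp flip: vec_total_eq_0_iff)

lemma lancaster_eq_Q:
  assumes "r 0 = 1" and "lancaster_term l0 \<mu> u a r x y summable_on {n. vec_total n \<ge> 1}"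
  shows "lancaster l0 \<mu> u a r x y = Q r x y"
proof -
  have s: "(\<lambda>n. r n * DD x y n) summable_on UNIV - {0}"
    using assms(2) unfolding pos_degrees lancaster_term_DD[abs_def] .
  have "F r x y = (\<Sum>\<^sub>\<infinity>n\<in>insert 0 (UNIV - {0}). r n * DD x y n)"
    by (simp add: F_def insert_absorb)
  also have "\<dots> = r 0 * DD x y 0 + (\<Sum>\<^sub>\<infinity>n\<in>UNIV - {0}. r n * DD x y n)"
    using s by (subst infsum_insert) auto
  finally show ?thesis
    unfolding lancaster_def pos_degrees lancaster_term_DD[abs_def] Q_def using assms(1) by (simp add: DD_def)
qed

lemma lancaster_summable:
  assumes "\<And>n. \<bar>r n\<bar> \<le> 1"
  shows "lancaster_term l0 \<mu> u a r x y summable_on {n. vec_total n \<ge> 1}"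
proof -
  have "(\<lambda>n. r n * DD x y n) summable_on UNIV"
    using F_has_sum[of r x y, OF assms] by (auto simp: summable_on_def)
  then show ?thesis
    unfolding lancaster_term_DD[abs_def] by (rule summable_on_subset_banach) auto
qed

lemma Q_eigen_left:
  assumes "\<And>n. \<bar>r n\<bar> \<le> 1"
  shows "((\<lambda>x. Q r x y * D m x) has_sum (r m * P y * D m y)) UNIV"
  using has_sum_cmult_right[OF F_eigen[of r y m, OF assms], of "P y"]
  by (simp add: Q_def mult_ac)

lemma Q_eigen_right:
  assumes "\<And>n. \<bar>r n\<bar> \<le> 1"
  shows "((\<lambda>y. Q r x y * D m y) has_sum (r m * P x * D m x)) UNIV"
  using Q_eigen_left[of r x m, OF assms] by (simp add: Q_commute[of r _ x])

lemma EP_has_sum: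
  assumes "exp_bounded f"
  shows "((\<lambda>x. P x * f x) has_sum EP f) UNIV"
  unfolding EP_def by (intro has_sum_infsum P_summable assms)

text \<open>The iterated sum follows from \<open>Q_eigen_left\<close> and orthogonality. To pass to
  pairs, |ab| <= a^2 + b^2 dominates the summand by functions of one variable, whose sums against
  the non-negative \<open>Q\<close> reduce to the Poisson marginals.\<close>

lemma Q_correlation:
  assumes r: "\<And>n. \<bar>r n\<bar> \<le> 1" and r0: "r 0 = 1" and nonneg: "\<And>x y. Q r x y \<ge> 0"
  shows "((\<lambda>(x, y). Q r x y * (D m x * D n y)) has_sum (if m = n then r n / h n else 0)) UNIV"
proof (rule has_sum_fubini(1))
  have sq: "(\<lambda>(x, y). Q r x y * (D m x)\<^sup>2) summable_on UNIV" for m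
  proof (rule summable_on_product_real[of _ "\<lambda>x. P x * (D m x)\<^sup>2"])
    fix x
    \<comment> \<open>Since \<open>D 0\<close> = 1, the eigenvalue relation in degree 0 is the
      statement about the marginal.\<close>
    have "((\<lambda>y. (D m x)\<^sup>2 * (Q r x y * D 0 y)) has_sum ((D m x)\<^sup>2 * (r 0 * P x * D 0 x))) UNIV"
      by (intro has_sum_cmult_right Q_eigen_right r)
    then show "((\<lambda>y. \<bar>Q r x y * (D m x)\<^sup>2\<bar>) has_sum P x * (D m x)\<^sup>2) UNIV"
      using nonneg by (simp add: r0 mult_ac abs_mult)
  next
    show "(\<lambda>x. P x * (D m x)\<^sup>2) summable_on UNIV"
      unfolding power2_eq_square by (intro P_summable exp_bounded_intros)
  qed
  have sq': "(\<lambda>(x, y). Q r x y * (D n y)\<^sup>2) summable_on UNIV"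
    using sq[of n] unfolding UNIV_Times_UNIV[symmetric]
    by (subst summable_on_swap) (simp add: case_prod_unfold Q_commute[of r "snd _"])
  have "(\<lambda>z. \<bar>case z of (x, y) \<Rightarrow> Q r x y * (D m x * D n y)\<bar>) summable_on UNIV"
  proof (rule summable_on_comparison_test[OF summable_on_add[OF sq[of m] sq']])
    fix z :: "(nat ^ 'd) \<times> (nat ^ 'd)"
    obtain x y where z: "z = (x, y)" by (cases z)
    have "\<bar>D m x * D n y\<bar> \<le> (D m x)\<^sup>2 + (D n y)\<^sup>2"
      using sum_squares_bound[of "\<bar>D m x\<bar>" "\<bar>D n y\<bar>"] abs_ge_zero[of "D m x * D n y"]
      unfolding abs_mult power2_abs by linarith
    from mult_left_mono[OF this nonneg[of x y]]
    show "\<bar>case z of (x, y) \<Rightarrow> Q r x y * (D m x * D n y)\<bar>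
        \<le> (case z of (x, y) \<Rightarrow> Q r x y * (D m x)\<^sup>2) + (case z of (x, y) \<Rightarrow> Q r x y * (D n y)\<^sup>2)"
      using nonneg[of x y] by (simp add: z abs_mult distrib_left)
  qed auto
  then show "(\<lambda>(x, y). Q r x y * (D m x * D n y)) summable_on UNIV"
    by (subst summable_on_iff_abs_summable_on_real) simp
  show "((\<lambda>x. Q r x y * (D m x * D n y)) has_sum r m * P y * D m y * D n y) UNIV" for y
    using has_sum_cmult_left[OF Q_eigen_left[of r y m, OF r], of "D n y"] by (simp add: mult_ac)
  show "((\<lambda>y. Q r x y * (D m x * D n y)) has_sum r n * P x * D n x * D m x) UNIV" for x
    using has_sum_cmult_left[OF Q_eigen_right[of r x n, OF r], of "D m x"] by (simp add: mult_ac)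
  have "((\<lambda>y. P y * (D m y * D n y)) has_sum (if m = n then 1 / h n else 0)) UNIV"
    using EP_has_sum[OF exp_bounded_mult[OF exp_bounded_D[of m] exp_bounded_D[of n]]]
    unfolding EP_D_orth by (cases "m = n") simp_all
  from has_sum_cmult_right[OF this, of "r m"]
  show "((\<lambda>y. r m * P y * D m y * D n y) has_sum (if m = n then r n / h n else 0)) UNIV"
    by (auto simp: mult_ac split: if_splits)
qed

lemma lancaster_expansion_Q:
  assumes r: "\<And>n. \<bar>r n\<bar> \<le> 1" and r0: "r 0 = 1" and nonneg: "\<And>x y. Q r x y \<ge> 0"
  shows "lancaster_expansion l0 \<mu> u a r" and "lancaster l0 \<mu> u a r x y = Q r x y"
proof -
  show eq: "lancaster l0 \<mu> u a r x y = Q r x y" for x y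
    by (intro lancaster_eq_Q lancaster_summable r r0)
  have "((\<lambda>(x, y). lancaster l0 \<mu> u a r x y * (charlier l0 \<mu> u m x * charlier l0 \<mu> u n y))
      has_sum (if m = n then r n * inverse (h n) else 0)) UNIV" for m n
  proof -
    have "((\<lambda>z. ((- 1) ^ (m $ l0) * (- 1) ^ (n $ l0)) * (case z of (x, y) \<Rightarrow> Q r x y * (D m x * D n y)))
        has_sum ((- 1) ^ (m $ l0) * (- 1) ^ (n $ l0)) * (if m = n then r n / h n else 0)) UNIV"
      by (intro has_sum_cmult_right Q_correlation assms)
    moreover have "((- 1) ^ (m $ l0) * (- 1) ^ (n $ l0)) * (if m = n then r n / h n else 0)
        = (if m = n then r n * inverse (h n) else 0)"
      by (simp add: divide_inverse flip: power_mult_distrib)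
    moreover have "(\<lambda>z. ((- 1) ^ (m $ l0) * (- 1) ^ (n $ l0)) * (case z of (x, y) \<Rightarrow> Q r x y * (D m x * D n y)))
        = (\<lambda>(x, y). lancaster l0 \<mu> u a r x y * (charlier l0 \<mu> u m x * charlier l0 \<mu> u n y))"
      by (simp add: fun_eq_iff eq charlier_D mult_ac)
    ultimately show ?thesis by simp
  qed
  with lancaster_summable[of r, OF r] show "lancaster_expansion l0 \<mu> u a r"
    unfolding lancaster_expansion_def by blast
qed

lemma Q_pmf:
  assumes r: "\<And>n. \<bar>r n\<bar> \<le> 1" and r0: "r 0 = 1" and nonneg: "\<And>x y. Q r x y \<ge> 0"
  obtains q where "bivariate_poisson \<mu> q" "\<And>x y. pmf q (x, y) = Q r x y"
proof -
  have "((\<lambda>(x, y). Q r x y) has_sum 1) UNIV"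
    using Q_correlation[of r 0 0, OF assms] by (simp add: r0)
  then obtain q where q: "\<And>z. pmf q z = (case z of (x, y) \<Rightarrow> Q r x y)"
    using has_sum_imp_pmf[of "\<lambda>(x, y). Q r x y"] nonneg by (metis (no_types, lifting) case_prod_unfold)
  have "pmf (map_pmf fst q) x = P x" for x
    by (rule pmf_map_has_sum[of "\<lambda>y. (x, y)"])
      (use Q_eigen_right[of r x 0, OF r] in \<open>auto simp: q r0 inj_on_def\<close>)
  moreover have "pmf (map_pmf snd q) y = P y" for y
    by (rule pmf_map_has_sum[of "\<lambda>x. (x, y)"])
      (use Q_eigen_left[of r y 0, OF r] in \<open>auto simp: q r0 inj_on_def\<close>)
  ultimately show ?thesis
    using that[of q] by (simp add: bivariate_poisson_def q)
qed

section \<open>Mixtures over the simplex\<close>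

lemma lin_le_1:
  assumes "\<xi> \<in> unit_simplex"
  shows "\<bar>lin \<xi> j\<bar> \<le> 1"
  using assms lin_abs_le[of \<xi> j] by (force simp: unit_simplex_def)

lemma lin_measurable [measurable]: "(\<lambda>\<xi>. lin \<xi> j) \<in> borel_measurable borel"
  unfolding lin_def by (intro borel_measurable_continuous_onI continuous_intros)

lemma monp_lin_measurable [measurable]: "(\<lambda>\<xi>. monp (lin \<xi>) n) \<in> borel_measurable borel"
  unfolding monp_def by measurable

lemma mixture_moments:
  assumes "prob_space \<nu>" and sets: "sets \<nu> = sets borel" and supp: "AE \<xi> in \<nu>. \<xi> \<in> unit_simplex"
    and r: "\<And>n. r n = (\<integral>\<xi>. monp (lin \<xi>) n \<partial>\<nu>)"
  shows "\<bar>r n\<bar> \<le> 1" and "F r x y \<ge> 0"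
proof -
  interpret prob_space \<nu> by fact
  have meas: "(\<lambda>\<xi>. monp (lin \<xi>) n) \<in> borel_measurable \<nu>" for n
    using monp_lin_measurable sets measurable_cong_sets by blast
  have AE1: "AE \<xi> in \<nu>. \<bar>monp (lin \<xi>) n\<bar> \<le> 1" for n
    using supp by eventually_elim (intro monp_le_1 lin_le_1)
  have int: "integrable \<nu> (\<lambda>\<xi>. monp (lin \<xi>) n)" for n
    by (rule integrable_const_bound[where B = 1]) (use AE1 meas in auto)
  show r1: "\<bar>r n\<bar> \<le> 1" for n
  proof -
    have "\<bar>r n\<bar> \<le> (\<integral>\<xi>. \<bar>monp (lin \<xi>) n\<bar> \<partial>\<nu>)"
      unfolding r by (rule integral_abs_bound)
    also have "\<dots> \<le> (\<integral>\<xi>. 1 \<partial>\<nu>)"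
      by (intro integral_mono_AE) (use AE1 int in auto)
    finally show ?thesis by (simp add: prob_space)
  qed
  define T where "T = (\<Sum>\<^sub>\<infinity>n. \<bar>DD x y n\<bar>)"
  have T: "((\<lambda>n. \<bar>DD x y n\<bar>) has_sum T) UNIV"
    unfolding T_def by (intro has_sum_infsum DD_summable)
  \<comment> \<open>Summation and integration need not be exchanged exactly. Subtracting from the
    absolute series makes the terms non-negative, so finite partial sums stay below T - F(xi) <= T
    pointwise in xi, and only finite sums are integrated.\<close>
  have "T - F r x y \<le> T"
  proof (rule has_sum_le_finite_sums)
    show "((\<lambda>n. \<bar>DD x y n\<bar> - r n * DD x y n) has_sum (T - F r x y)) UNIV"
      by (intro has_sum_diff T F_has_sum r1)
    fix X :: "(nat ^ 'd) set"
    assume "finite X"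
    have "(\<Sum>n\<in>X. \<bar>DD x y n\<bar> - r n * DD x y n)
        = (\<integral>\<xi>. (\<Sum>n\<in>X. \<bar>DD x y n\<bar> - monp (lin \<xi>) n * DD x y n) \<partial>\<nu>)"
      using int by (simp add: r prob_space)
    also have "\<dots> \<le> (\<integral>\<xi>. T \<partial>\<nu>)"
    proof (intro integral_mono_AE)
      show "AE \<xi> in \<nu>. (\<Sum>n\<in>X. \<bar>DD x y n\<bar> - monp (lin \<xi>) n * DD x y n) \<le> T"
        using supp
      proof eventually_elim
        case (elim \<xi>)
        have m1: "\<bar>monp (lin \<xi>) n\<bar> \<le> 1" for n
          by (intro monp_le_1 lin_le_1 elim)
        have "(\<Sum>n\<in>X. \<bar>DD x y n\<bar> - monp (lin \<xi>) n * DD x y n) \<le> T - F (monp (lin \<xi>)) x y"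
        proof (rule finite_sum_le_has_sum)
          show "((\<lambda>n. \<bar>DD x y n\<bar> - monp (lin \<xi>) n * DD x y n) has_sum (T - F (monp (lin \<xi>)) x y)) UNIV"
            by (intro has_sum_diff T F_has_sum m1)
          fix n
          have "\<bar>monp (lin \<xi>) n * DD x y n\<bar> \<le> 1 * \<bar>DD x y n\<bar>"
            unfolding abs_mult by (intro mult_right_mono m1) auto
          then show "0 \<le> \<bar>DD x y n\<bar> - monp (lin \<xi>) n * DD x y n" by linarith
        qed (use \<open>finite X\<close> in auto)
        then show ?case using F_lin_nonneg[OF elim, of x y] by linarith
      qed
    qed (use int in auto)
    finally show "(\<Sum>n\<in>X. \<bar>DD x y n\<bar> - r n * DD x y n) \<le> T" by (simp add: prob_space)
  qed
  then show "F r x y \<ge> 0" by simp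
qed

end

section \<open>Sequential compactness on the cube\<close>

definition binary_digit :: "real \<Rightarrow> nat \<Rightarrow> nat" where
  "binary_digit x n = nat (\<lfloor>2 ^ Suc n * x\<rfloor> - 2 * \<lfloor>2 ^ n * x\<rfloor>)"

lemma binary_digit_diff:
  "real (binary_digit x n) = of_int (\<lfloor>2 ^ Suc n * x\<rfloor> - 2 * \<lfloor>2 ^ n * x\<rfloor>)" "binary_digit x n \<in> {0, 1}"
proof -
  define y where "y = 2 ^ n * x"
  have "\<lfloor>2 * y\<rfloor> - 2 * \<lfloor>y\<rfloor> \<in> {0, 1}"
    by (auto, linarith)
  then show "real (binary_digit x n) = of_int (\<lfloor>2 ^ Suc n * x\<rfloor> - 2 * \<lfloor>2 ^ n * x\<rfloor>)" "binary_digit x n \<in> {0, 1}"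
    unfolding binary_digit_def by (auto simp: y_def mult.assoc)
qed

lemma binary_digit_sums:
  assumes "0 \<le> x" "x < 1"
  shows "(\<lambda>n. binary_digit x n / 2 ^ Suc n) sums x"
proof -
  have partial: "(\<Sum>k<n. binary_digit x k / 2 ^ Suc k) = \<lfloor>2 ^ n * x\<rfloor> / 2 ^ n" for n
  proof (induction n)
    case 0
    have "\<lfloor>x\<rfloor> = 0" using assms by linarith
    then show ?case by simp
  next
    case (Suc n)
    then show ?case unfolding sum.lessThan_Suc Suc binary_digit_diff(1) by (simp add: field_simps)
  qed
  have "(\<lambda>n. \<lfloor>2 ^ n * x\<rfloor> / 2 ^ n) \<longlonglongrightarrow> x"
  proof (rule tendsto_sandwich[OF _ _ _ tendsto_const])
    have "x - (1 / 2) ^ n \<le> \<lfloor>2 ^ n * x\<rfloor> / 2 ^ n" for n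
    proof -
      have "(2 ^ n * x - 1) / 2 ^ n \<le> \<lfloor>2 ^ n * x\<rfloor> / 2 ^ n" by (intro divide_right_mono) (linarith, simp)
      then show ?thesis by (simp add: diff_divide_distrib power_one_over)
    qed
    then show "\<forall>\<^sub>F n in sequentially. x - (1 / 2) ^ n \<le> \<lfloor>2 ^ n * x\<rfloor> / 2 ^ n" by simp
    have "\<lfloor>2 ^ n * x\<rfloor> / 2 ^ n \<le> x" for n
      by (simp add: divide_le_eq mult.commute)
    then show "\<forall>\<^sub>F n in sequentially. \<lfloor>2 ^ n * x\<rfloor> / 2 ^ n \<le> x" by simp
    have "(\<lambda>n. x - (1 / 2) ^ n) \<longlonglongrightarrow> x - 0"
      by (intro tendsto_diff tendsto_const LIMSEQ_realpow_zero) auto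
    then show "(\<lambda>n. x - (1 / 2) ^ n) \<longlonglongrightarrow> x" by simp
  qed
  then show ?thesis unfolding sums_def partial .
qed

text \<open>For b with values 0 and 1: the point of the Cantor set with ternary digits 2
  b_n.\<close>

definition cantor_point :: "(nat \<Rightarrow> nat) \<Rightarrow> real" where
  "cantor_point b = suminf (\<lambda>n. 2 * real (b n) / 3 ^ Suc n)"

lemma cantor_point_summable:
  assumes "\<And>n. b n \<in> {0, 1}"
  shows "summable (\<lambda>n. 2 * real (b n) / 3 ^ Suc n)"
proof (rule summable_comparison_test'[where N = 0])
  show "summable (\<lambda>n. 2 / 3 * (1 / 3 :: real) ^ n)"
    by (intro summable_mult summable_geometric) auto
  show "norm (2 * real (b n) / 3 ^ Suc n) \<le> 2 / 3 * (1 / 3) ^ n" for n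
    using assms[of n] by (auto simp: power_one_over)
qed

lemma cantor_point_bounds:
  assumes "\<And>n. b n \<in> {0, 1}"
  shows "0 \<le> cantor_point b" "cantor_point b \<le> 1"
proof -
  note s = cantor_point_summable[OF assms]
  show "0 \<le> cantor_point b"
    unfolding cantor_point_def by (intro suminf_nonneg s) auto
  have "cantor_point b \<le> suminf (\<lambda>n. 2 / 3 * (1 / 3) ^ n)"
    unfolding cantor_point_def
  proof (intro suminf_le s summable_mult summable_geometric)
    show "2 * real (b n) / 3 ^ Suc n \<le> 2 / 3 * (1 / 3) ^ n" for n
      using assms[of n] by (auto simp: power_one_over)
  qed auto
  also have "\<dots> = 1" by (subst suminf_mult) (auto simp: suminf_geometric)
  finally show "cantor_point b \<le> 1" .
qed

lemma cantor_point_unfold: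
  assumes "\<And>n. b n \<in> {0, 1}"
  shows "3 * cantor_point b = 2 * real (b 0) + cantor_point (\<lambda>n. b (Suc n))"
proof -
  have "cantor_point b = 2 * real (b 0) / 3 + suminf (\<lambda>n. 2 * real (b (Suc n)) / 3 ^ Suc (Suc n))"
    unfolding cantor_point_def by (subst suminf_split_head[OF cantor_point_summable[of b, OF assms]]) auto
  also have "suminf (\<lambda>n. 2 * real (b (Suc n)) / 3 ^ Suc (Suc n)) = suminf (\<lambda>n. 2 * real (b (Suc n)) / 3 ^ Suc n / 3)"
    by (simp add: field_simps)
  also have "\<dots> = cantor_point (\<lambda>n. b (Suc n)) / 3"
    unfolding cantor_point_def
    by (rule suminf_divide) (rule cantor_point_summable, rule assms)
  finally show ?thesis by (simp add: field_simps)
qed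

text \<open>Scaling by 3^k shifts the digits. As the digits are 0 or 2, the part split off is an
  even integer, invisible to functions of period 2.\<close>

lemma cantor_point_scale:
  assumes "\<And>n. b n \<in> {0, 1}"
  shows "\<exists>N :: int. 3 ^ k * cantor_point b = 2 * real_of_int N + cantor_point (\<lambda>n. b (n + k))"
proof (induction k)
  case 0
  then show ?case by (intro exI[of _ 0]) simp
next
  case (Suc k)
  then obtain N :: int where N: "3 ^ k * cantor_point b = 2 * real_of_int N + cantor_point (\<lambda>n. b (n + k))" by blast
  have "3 ^ Suc k * cantor_point b = 3 * (3 ^ k * cantor_point b)" by simp
  also have "\<dots> = 2 * (3 * N + b k) + cantor_point (\<lambda>n. b (n + Suc k))"
    using cantor_point_unfold[of "\<lambda>n. b (n + k)"] assms unfolding N by simp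
  finally show ?case by (intro exI[of _ "3 * N + b k"]) simp
qed

text \<open>A continuous function of period 2 that is 0 on [0,1/3] and 1 on [2/3,1]: it reads off
  whether the leading ternary digit is 0 or 2.\<close>

definition clipped_cos :: "real \<Rightarrow> real" where
  "clipped_cos t = max 0 (min 1 (1 / 2 - cos (pi * t)))"

lemma clipped_cos_scale:
  assumes "\<And>n. b n \<in> {0, 1}"
  shows "clipped_cos (3 ^ k * cantor_point b) = b k"
proof -
  obtain N :: int where N: "3 ^ k * cantor_point b = 2 * real_of_int N + cantor_point (\<lambda>n. b (n + k))"
    using cantor_point_scale[of b, OF assms] by blast
  define t where "t = cantor_point (\<lambda>n. b (n + k))"
  define s where "s = cantor_point (\<lambda>n. b (Suc n + k))"
  have s: "0 \<le> s" "s \<le> 1" using cantor_point_bounds[of "\<lambda>n. b (Suc n + k)", OF assms] unfolding s_def by auto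
  have t: "3 * t = 2 * real (b k) + s"
    using cantor_point_unfold[of "\<lambda>n. b (n + k)"] assms by (simp add: t_def s_def)
  have "cos (pi * (2 * N + t)) = cos (pi * t)"
  proof -
    have "pi * (2 * N + t) = pi * t + 2 * pi * N" by (simp add: algebra_simps)
    then show ?thesis by (simp only: cos_add cos_int_2pin sin_int_2pin) 
  qed
  then have c: "clipped_cos (3 ^ k * cantor_point b) = max 0 (min 1 (1 / 2 - cos (pi * t)))"
    by (simp add: clipped_cos_def N t_def)
  have "b k = 0 \<or> b k = 1" using assms by blast
  then show ?thesis
  proof
    assume b: "b k = 0"
    then have "0 \<le> t" "t \<le> 1 / 3" using t s by auto
    then have "cos (pi / 3) \<le> cos (pi * t)"
      by (intro cos_monotone_0_pi_le) auto
    then show ?thesis by (simp add: c b cos_60)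
  next
    assume b: "b k = 1"
    then have "2 / 3 \<le> t" "t \<le> 1" using t s by auto
    then have "cos (pi * t) \<le> cos (pi * 2 / 3)"
      by (intro cos_monotone_0_pi_le) auto
    then show ?thesis by (simp add: c b cos_120')
  qed
qed

text \<open>
  Schoenberg's space-filling curve: the ternary digits $0,2$ of a point of the Cantor set,
  distributed over the coordinates, are the binary digits of its image.
\<close>

lemma space_filling_curve:
  obtains \<phi> :: "real \<Rightarrow> real ^ 'd"
  where "continuous_on UNIV \<phi>" "\<And>t i. 0 \<le> \<phi> t $ i \<and> \<phi> t $ i \<le> 1"
    and "\<And>z. (\<And>i. 0 \<le> z $ i \<and> z $ i < 1) \<Longrightarrow> \<exists>t\<in>{0..1}. \<phi> t = z"
proof -
  define d where "d = CARD('d)"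
  have d: "d > 0" by (simp add: d_def)
  obtain idx :: "'d \<Rightarrow> nat" where idx: "bij_betw idx UNIV {0..<d}"
    unfolding d_def using ex_bij_betw_finite_nat[of "UNIV :: 'd set"] by auto
  \<comment> \<open>Coordinate i owns the digit positions congruent to \<open>idx i\<close> modulo
    d; the summand reads the n-th of them and weights it as a binary digit.\<close>
  define f where "f i n t = clipped_cos (3 ^ (d * n + idx i) * t) / 2 ^ Suc n" for i n t
  have clip: "0 \<le> clipped_cos t" "clipped_cos t \<le> 1" for t
    by (auto simp: clipped_cos_def)
  have geo: "summable (\<lambda>n. 1 / 2 ^ Suc n :: real)" "suminf (\<lambda>n. 1 / 2 ^ Suc n :: real) = 1"
    using power_half_series by (auto simp: sums_iff power_one_over)
  have fb: "0 \<le> f i n t" "f i n t \<le> 1 / 2 ^ Suc n" for i n t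
    using clip by (auto simp: f_def divide_right_mono)
  have fs: "summable (\<lambda>n. f i n t)" for i t
    by (rule summable_comparison_test'[OF geo(1), of 0]) (use fb in auto)
  define \<phi> where "\<phi> t = (\<chi> i. suminf (\<lambda>n. f i n t))" for t
  have "continuous_on UNIV (\<lambda>t. suminf (\<lambda>n. f i n t))" for i
  proof (rule uniform_limit_theorem)
    show "uniform_limit UNIV (\<lambda>n t. \<Sum>k<n. f i k t) (\<lambda>t. suminf (\<lambda>n. f i n t)) sequentially"
      by (rule Weierstrass_m_test[OF _ geo(1)]) (use fb in auto)
    show "\<forall>\<^sub>F n in sequentially. continuous_on UNIV (\<lambda>t. \<Sum>k<n. f i k t)"
      unfolding f_def clipped_cos_def by (intro always_eventually allI continuous_intros) auto
  qed simp
  then have cont: "continuous_on UNIV \<phi>"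
    unfolding \<phi>_def by (intro continuous_on_vec_lambda)
  have bounds: "0 \<le> \<phi> t $ i \<and> \<phi> t $ i \<le> 1" for t i
  proof
    show "0 \<le> \<phi> t $ i" unfolding \<phi>_def using fs fb by (auto intro: suminf_nonneg)
    have "suminf (\<lambda>n. f i n t) \<le> suminf (\<lambda>n. 1 / 2 ^ Suc n)" by (intro suminf_le fs fb geo)
    then show "\<phi> t $ i \<le> 1" using geo by (simp add: \<phi>_def)
  qed
  have surj: "\<exists>t\<in>{0..1}. \<phi> t = z" if z: "\<And>i. 0 \<le> z $ i \<and> z $ i < 1" for z
  proof -
    \<comment> \<open>The inverse of the interleaving: the residue of k selects the coordinate, the
      quotient the digit.\<close>
    define b where "b k = binary_digit (z $ (inv_into UNIV idx (k mod d))) (k div d)" for k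
    have b01: "b k \<in> {0, 1}" for k unfolding b_def by (rule binary_digit_diff)
    have b: "b (d * n + idx i) = binary_digit (z $ i) n" for i n
    proof -
      have "idx i < d" using idx by (auto simp: bij_betw_def)
      moreover have "inv_into UNIV idx (idx i) = i"
        using idx by (simp add: bij_betw_def)
      ultimately show ?thesis by (simp add: b_def)
    qed
    have "\<phi> (cantor_point b) $ i = z $ i" for i
    proof -
      have "\<phi> (cantor_point b) $ i = suminf (\<lambda>n. binary_digit (z $ i) n / 2 ^ Suc n)"
        by (simp add: \<phi>_def f_def clipped_cos_scale[OF b01] b)
      also have "\<dots> = z $ i" using binary_digit_sums[of "z $ i"] z by (simp add: sums_iff)
      finally show ?thesis .
    qed
    then have "\<phi> (cantor_point b) = z" by (simp add: vec_eq_iff)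
    then show ?thesis using cantor_point_bounds[OF b01] by auto
  qed
  show ?thesis by (rule that[OF cont bounds surj])
qed

text \<open>
  Sequential compactness of the laws on a cube, pulled back to Helly's theorem on the line
  along the curve.
\<close>

lemma cube_laws_compact:
  fixes q :: "nat \<Rightarrow> 'a pmf" and X :: "nat \<Rightarrow> 'a \<Rightarrow> real ^ 'd"
  assumes X: "\<And>m x i. 0 \<le> X m x $ i \<and> X m x $ i < 1"
  obtains r :: "nat \<Rightarrow> nat" and \<nu> :: "(real ^ 'd) measure"
  where "strict_mono r" "prob_space \<nu>" "sets \<nu> = sets borel" "AE z in \<nu>. \<forall>i. 0 \<le> z $ i \<and> z $ i \<le> 1"
    and "\<And>f :: real ^ 'd \<Rightarrow> real. continuous_on UNIV f \<Longrightarrow>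
      (\<lambda>m. measure_pmf.expectation (q (r m)) (\<lambda>x. f (X (r m) x))) \<longlonglongrightarrow> integral\<^sup>L \<nu> f"
proof -
  obtain \<phi> :: "real \<Rightarrow> real ^ 'd" where cont: "continuous_on UNIV \<phi>"
    and \<phi>: "\<And>t i. 0 \<le> \<phi> t $ i \<and> \<phi> t $ i \<le> 1"
    and surj: "\<And>z. (\<And>i. 0 \<le> z $ i \<and> z $ i < 1) \<Longrightarrow> \<exists>t\<in>{0..1}. \<phi> t = z"
    using space_filling_curve by blast
  \<comment> \<open>Any choice of parameters will do: every function on the sample space of a
    \<open>pmf\<close> is measurable.\<close>
  have "\<exists>T. T \<in> {0..1} \<and> \<phi> T = X m x" for m x
    using surj[of "X m x"] X[of m x] by blast
  then obtain T where T: "\<And>m x. T m x \<in> {0..1}" "\<And>m x. \<phi> (T m x) = X m x"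
    by metis
  define \<tau> where "\<tau> m = distr (measure_pmf (q m)) borel (T m)" for m
  have rd: "real_distribution (\<tau> m)" for m
    unfolding \<tau>_def by (rule prob_space.real_distribution_distr[OF measure_pmf.prob_space_axioms]) simp
  \<comment> \<open>All mass sits in [0,1]; the left end -1 keeps the point 0 inside the half-open
    interval.\<close>
  have "tight \<tau>"
    unfolding tight_def
  proof (intro conjI allI impI rd)
    fix \<epsilon> :: real assume "\<epsilon> > 0"
    have "measure (\<tau> m) {-1<..1} = 1" for m
    proof -
      have "- 1 < T m x \<and> T m x \<le> 1" for x
        using T(1)[of m x] by auto
      then have "T m -` {-1<..1} = UNIV" by auto
      then show ?thesis by (simp add: \<tau>_def measure_distr)
    qed
    then show "\<exists>a b. a < b \<and> (\<forall>n. 1 - \<epsilon> < measure (\<tau> n) {a<..b})"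
      using \<open>\<epsilon> > 0\<close> by (intro exI[of _ "-1"] exI[of _ 1]) auto
  qed
  from tight_imp_convergent_subsubsequence[OF this strict_mono_id]
  obtain r L where r: "strict_mono (r :: nat \<Rightarrow> nat)" and L: "real_distribution L"
    and w: "weak_conv_m (\<tau> \<circ> r) L" by auto
  interpret L: real_distribution L by fact
  have meas: "\<phi> \<in> borel_measurable borel"
    by (rule borel_measurable_continuous_onI[OF cont])
  then have measL: "\<phi> \<in> measurable L borel" by simp
  define \<nu> where "\<nu> = distr L borel \<phi>"
  have box: "cbox 0 1 = {z :: real ^ 'd. \<forall>i. 0 \<le> z $ i \<and> z $ i \<le> 1}"
    by (auto simp: mem_box_cart)
  show ?thesis
  proof (rule that[OF r])
    show "prob_space \<nu>" unfolding \<nu>_def by (rule L.prob_space_distr[OF measL])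
    show "sets \<nu> = sets borel" by (simp add: \<nu>_def)
    show "AE z in \<nu>. \<forall>i. 0 \<le> z $ i \<and> z $ i \<le> 1"
    proof -
      have "cbox 0 1 \<in> sets (borel :: (real ^ 'd) measure)"
        by (intro borel_closed closed_cbox)
      then have "{z \<in> space (borel :: (real ^ 'd) measure). \<forall>i. 0 \<le> z $ i \<and> z $ i \<le> 1} \<in> sets borel"
        by (simp only: box space_borel UNIV_I simp_thms)
      then show ?thesis
        unfolding \<nu>_def using \<phi> by (subst AE_distr_iff[OF measL]) auto
    qed
    fix f :: "real ^ 'd \<Rightarrow> real" assume f: "continuous_on UNIV f"
    \<comment> \<open>f need not be bounded, but the curve stays in the cube, so f composed with the
      curve is bounded and weak convergence applies.\<close>
    have "compact (f ` cbox 0 1)"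
      by (intro compact_continuous_image continuous_on_subset[OF f] compact_cbox) auto
    then have "bounded (f ` cbox 0 1)"
      by (rule compact_imp_bounded)
    then obtain B where "\<forall>y\<in>f ` cbox 0 1. norm y \<le> B"
      unfolding bounded_iff by blast
    then have B: "\<bar>f z\<bar> \<le> B" if "\<forall>i. 0 \<le> z $ i \<and> z $ i \<le> 1" for z
      using that unfolding box by auto
    have cf: "continuous_on UNIV (\<lambda>t. f (\<phi> t))"
      by (rule continuous_on_compose2[OF f cont]) auto
    have fm: "f \<in> borel_measurable borel" by (rule borel_measurable_continuous_onI[OF f])
    have "(\<lambda>m. integral\<^sup>L ((\<tau> \<circ> r) m) (\<lambda>t. f (\<phi> t))) \<longlonglongrightarrow> integral\<^sup>L L (\<lambda>t. f (\<phi> t))"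
    proof (rule weak_conv_imp_integral_bdd_continuous_conv[where B = B])
      show "real_distribution ((\<tau> \<circ> r) m)" for m using rd by simp
      show "isCont (\<lambda>t. f (\<phi> t)) t" for t using cf by (simp add: continuous_on_eq_continuous_at)
      show "norm (f (\<phi> t)) \<le> B" for t using B[of "\<phi> t"] \<phi> by simp
    qed (use L w in \<open>auto simp: o_def\<close>)
    moreover have "integral\<^sup>L ((\<tau> \<circ> r) m) (\<lambda>t. f (\<phi> t))
        = measure_pmf.expectation (q (r m)) (\<lambda>x. f (X (r m) x))" for m
      unfolding \<tau>_def o_def
      by (subst integral_distr) (use T(2) fm meas in auto)
    moreover have "integral\<^sup>L L (\<lambda>t. f (\<phi> t)) = integral\<^sup>L \<nu> f"
      unfolding \<nu>_def by (rule integral_distr[symmetric, OF measL fm])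
    ultimately show "(\<lambda>m. measure_pmf.expectation (q (r m)) (\<lambda>x. f (X (r m) x))) \<longlonglongrightarrow> integral\<^sup>L \<nu> f"
      by simp
  qed
qed

section \<open>Correlations are bounded by one\<close>

context hypergroup_basis
begin

text \<open>The span of the polynomials of degree strictly below N. The inductive form lets linear
  statements about expectations, growth and limits be proved by rule induction, and
  \<open>W (vec_total n)\<close> is the space of lower-order terms for degree n.\<close>

inductive_set W :: "nat \<Rightarrow> (nat ^ 'd \<Rightarrow> real) set" for N :: nat where
  zero: "(\<lambda>x. 0) \<in> W N"
| step: "f \<in> W N \<Longrightarrow> vec_total k < N \<Longrightarrow> (\<lambda>x. f x + c * D k x) \<in> W N"

lemma W_D: "vec_total k < N \<Longrightarrow> D k \<in> W N"
  using W.step[OF W.zero, of k N 1] by simp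

lemma W_add: "g \<in> W N \<Longrightarrow> f \<in> W N \<Longrightarrow> (\<lambda>x. f x + g x) \<in> W N"
proof (induction rule: W.induct)
  case (step g k c)
  then show ?case using W.step[of "\<lambda>x. f x + g x" N k c] by (simp add: add.assoc)
qed simp_all

lemma W_cmult: "f \<in> W N \<Longrightarrow> (\<lambda>x. c * f x) \<in> W N"
proof (induction rule: W.induct)
  case (step f k c')
  then show ?case using W.step[of "\<lambda>x. c * f x" N k "c * c'"] by (simp add: algebra_simps)
qed (simp add: W.zero)

lemma W_diff: "f \<in> W N \<Longrightarrow> g \<in> W N \<Longrightarrow> (\<lambda>x. f x - g x) \<in> W N"
  using W_add[OF W_cmult[of g N "-1"], of f] by simp

lemma W_sum: "(\<And>i. i \<in> I \<Longrightarrow> f i \<in> W N) \<Longrightarrow> (\<lambda>x. \<Sum>i\<in>I. f i x) \<in> W N"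
  by (induction I rule: infinite_finite_induct) (auto intro: W.zero W_add)

lemma W_mono: "f \<in> W N \<Longrightarrow> N \<le> N' \<Longrightarrow> f \<in> W N'"
  by (induction rule: W.induct) (auto intro: W.intros)

lemma W_if: "(b \<Longrightarrow> f \<in> W N) \<Longrightarrow> (\<lambda>x. if b then f x else 0) \<in> W N"
  by (cases b) (auto intro: W.zero)

definition U :: "'d \<Rightarrow> nat ^ 'd \<Rightarrow> real" where
  "U j x = (\<Sum>i\<in>UNIV. x $ i * u j $ i)"

text \<open>Expanding the weight g in the basis reduces the sum to those of \<open>D_lower\<close>,
  which have degree at most |m| + 1.\<close>

lemma weighted_lower_in_W:
  fixes g :: "'d \<Rightarrow> real"
  shows
  "(\<lambda>x. \<Sum>i\<in>UNIV. x $ i * g i * D m (x - axis i 1)) \<in> W (vec_total m + 2)"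
proof -
  have "(\<Sum>i\<in>UNIV. x $ i * g i * D m (x - axis i 1))
      = (\<Sum>r\<in>UNIV. fourier g r * M * ((real (m $ r) + 1) * D (m + axis r 1) x + (if r = l0 then D m x else 0)))" for x
  proof -
    have "(\<Sum>i\<in>UNIV. x $ i * g i * D m (x - axis i 1))
        = (\<Sum>i\<in>UNIV. \<Sum>r\<in>UNIV. fourier g r * (x $ i * u r $ i * D m (x - axis i 1)))"
    proof (intro sum.cong refl)
      fix i
      show "x $ i * g i * D m (x - axis i 1) = (\<Sum>r\<in>UNIV. fourier g r * (x $ i * u r $ i * D m (x - axis i 1)))"
        by (subst fourier_expansion[of g i]) (simp add: sum_distrib_left sum_distrib_right mult_ac)
    qed
    also have "\<dots> = (\<Sum>r\<in>UNIV. fourier g r * M * (\<Sum>i\<in>UNIV. x $ i * u r $ i / M * D m (x - axis i 1)))"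
      using M_pos by (subst sum.swap) (simp add: sum_distrib_left mult_ac)
    finally show ?thesis by (simp add: D_lower)
  qed
  then show ?thesis
    by (auto intro!: W_sum W_cmult W_add W_D W_if)
qed

text \<open>Rewriting D_n(x) through values at x - e_i by \<open>D_step\<close> splits the product
  in two. The unshifted part is evaluated by \<open>D_lower\<close> and gives the leading term; the
  rest carries the weights u^(j) u^(k) on polynomials of degree |n| - 1.\<close>

lemma U_D:
  "(\<lambda>x. U j x * D n x - M * (real (n $ j) + 1) * D (n + axis j 1) x) \<in> W (vec_total n + 1)"
proof -
  define L where "L k x = vshift k (\<lambda>m. \<Sum>i\<in>UNIV. x $ i * (u j $ i * u k $ i) * D m (x - axis i 1)) n" for k x
  have L: "L k \<in> W (vec_total n + 1)" for k
  proof (cases "n $ k = 0")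
    case True
    then show ?thesis by (simp add: L_def[abs_def] vshift_def W.zero)
  next
    case False
    \<comment> \<open>The shift loses one degree and the weighted sum regains at most one, so
      \<open>L k\<close> has degree at most |n|.\<close>
    have "vec_total (n - axis k 1) + 2 = vec_total n + 1"
      using arg_cong[OF axis_le_cancel[OF False], of vec_total] by simp
    with False show ?thesis
      using weighted_lower_in_W[of "\<lambda>i. u j $ i * u k $ i" "n - axis k 1"]
      by (simp add: L_def[abs_def] vshift_def Suc_eq_plus1)
  qed
  have "U j x * D n x - M * (real (n $ j) + 1) * D (n + axis j 1) x
      = M * (if j = l0 then D n x else 0) + (\<Sum>k\<in>UNIV. 1 / M * L k x)" for x
  proof -
    have "U j x * D n x = (\<Sum>i\<in>UNIV. x $ i * u j $ i * D n x)"
      by (simp add: U_def sum_distrib_right)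
    also have "\<dots> = (\<Sum>i\<in>UNIV. x $ i * u j $ i * (D n (x - axis i 1)
        + (\<Sum>k\<in>UNIV. u k $ i / M * vshift k (\<lambda>n. D n (x - axis i 1)) n)))"
    proof (intro sum.cong refl)
      fix i
      show "x $ i * u j $ i * D n x = x $ i * u j $ i * (D n (x - axis i 1)
        + (\<Sum>k\<in>UNIV. u k $ i / M * vshift k (\<lambda>n. D n (x - axis i 1)) n))"
      proof (cases "x $ i = 0")
        case False
        show ?thesis using D_step[of n "x - axis i 1" i] axis_le_cancel[OF False] by simp
      qed simp
    qed
    also have "\<dots> = M * (\<Sum>i\<in>UNIV. x $ i * u j $ i / M * D n (x - axis i 1))
        + (\<Sum>k\<in>UNIV. 1 / M * L k x)"
    proof -
      have "(\<Sum>i\<in>UNIV. x $ i * u j $ i * (\<Sum>k\<in>UNIV. u k $ i / M * vshift k (\<lambda>n. D n (x - axis i 1)) n))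
          = (\<Sum>k\<in>UNIV. 1 / M * L k x)"
        unfolding L_def vshift_sum vshift_cmult sum_distrib_left
        by (subst sum.swap) (simp add: mult_ac)
      then show ?thesis
        using M_pos by (simp add: distrib_left sum.distrib) (simp add: sum_distrib_left)
    qed
    also have "M * (\<Sum>i\<in>UNIV. x $ i * u j $ i / M * D n (x - axis i 1))
        = M * ((real (n $ j) + 1) * D (n + axis j 1) x + (if j = l0 then D n x else 0))"
      by (simp add: D_lower)
    finally show ?thesis by (simp add: algebra_simps)
  qed
  then show ?thesis
    by (simp only:) (intro W_add W_sum W_cmult L W_if W_D, simp)
qed

lemma U_W:
  assumes "f \<in> W N"
  shows "(\<lambda>x. U j x * f x) \<in> W (N + 1)"
  using assms
proof (induction rule: W.induct)
  case (step f k c)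
  have "(\<lambda>x. (U j x * D k x - M * (real (k $ j) + 1) * D (k + axis j 1) x)
      + M * (real (k $ j) + 1) * D (k + axis j 1) x) \<in> W (N + 1)"
    by (intro W_add W_cmult W_D W_mono[OF U_D]) (use step in auto)
  then have "(\<lambda>x. U j x * D k x) \<in> W (N + 1)" by simp
  from W_add[OF W_cmult[OF this, of c] step.IH] show ?case
    by (simp add: algebra_simps)
qed (simp add: W.zero)

text \<open>Iterating \<open>U_D\<close> multiplies the leading coefficient by M (n_j + 1) each
  time, which accumulates to M^|n| n!.\<close>

lemma monp_U_leading:
  "(\<lambda>x. monp (\<lambda>j. U j x) n - M ^ vec_total n * vfact n * D n x) \<in> W (vec_total n)"
proof (induction n rule: vec_nat_induct)
  case zero
  then show ?case by (simp add: vfact_def W.zero)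
next
  case (add n j)
  have "(\<lambda>x. U j x * (monp (\<lambda>j. U j x) n - M ^ vec_total n * vfact n * D n x)
      + M ^ vec_total n * vfact n * (U j x * D n x - M * (real (n $ j) + 1) * D (n + axis j 1) x))
      \<in> W (vec_total n + 1)"
    by (intro W_add W_cmult U_D U_W add.IH)
  then show ?case
    by (simp add: monp_add vfact_add power_add algebra_simps)
qed

text \<open>Solving \<open>U_D\<close> for the top polynomial expresses it by a linear form times
  one of lower degree, plus lower terms; \<open>U_W\<close> handles the linear form and induction
  the rest.\<close>

lemma D_mult_W: "f \<in> W N \<Longrightarrow> \<exists>N'. (\<lambda>x. D n x * f x) \<in> W N'"
proof (induction "vec_total n" arbitrary: n f N rule: less_induct)
  case less
  show ?case
  proof (cases "n = 0")
    case True
    then show ?thesis using less.prems by auto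
  next
    case False
    then obtain j where "n $ j \<noteq> 0" by (auto simp: vec_eq_iff)
    then obtain m where n: "n = m + axis j 1" using axis_le_cancel by metis
    have low: "\<exists>N'. (\<lambda>x. g x * f x) \<in> W N'" if "g \<in> W (vec_total n)" for g
      using that
    proof (induction rule: W.induct)
      case zero
      show ?case using W.zero[of 0] by auto
    next
      case (step g k c)
      obtain N1 N2 where "(\<lambda>x. g x * f x) \<in> W N1" "(\<lambda>x. D k x * f x) \<in> W N2"
        using step.IH less.hyps[OF step.hyps(2) less.prems] by blast
      then have "(\<lambda>x. g x * f x) \<in> W (max N1 N2)" "(\<lambda>x. c * (D k x * f x)) \<in> W (max N1 N2)"
        by (auto intro: W_mono W_cmult)
      from W_add[OF this] show ?case by (auto simp: algebra_simps)
    qed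
    define c where "c = M * (real (m $ j) + 1)"
    have c: "c \<noteq> 0" using M_pos by (simp add: c_def)
    obtain N1 where "(\<lambda>x. D m x * f x) \<in> W N1"
      using less.hyps[OF _ less.prems, of m] by (auto simp: n)
    from U_W[OF this, of j] have 1: "(\<lambda>x. U j x * (D m x * f x)) \<in> W (N1 + 1)" .
    obtain N2 where 2: "(\<lambda>x. (U j x * D m x - c * D n x) * f x) \<in> W N2"
      using low[of "\<lambda>x. U j x * D m x - c * D n x"] U_D[of j m] by (auto simp: n c_def)
    have "(\<lambda>x. 1 / c * (U j x * (D m x * f x) - (U j x * D m x - c * D n x) * f x)) \<in> W (max (N1 + 1) N2)"
      by (intro W_cmult W_diff W_mono[OF 1] W_mono[OF 2]) auto
    moreover have "1 / c * (U j x * (D m x * f x) - (U j x * D m x - c * D n x) * f x) = D n x * f x" for x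
      using c by (simp add: field_simps)
    ultimately show ?thesis by auto
  qed
qed

lemma W_exp_bounded: "f \<in> W N \<Longrightarrow> exp_bounded f"
proof (induction rule: W.induct)
  case (step f k c)
  show ?case by (rule exp_bounded_add[OF step.IH exp_bounded_cmult[OF exp_bounded_D]])
qed (rule exp_bounded_const)

text \<open>
  Since \<open>D n * D n\<close> lies in the span of the polynomials, its expectation under the joint law is
  determined by the correlations with \<open>D 0\<close>, hence equals the Poisson one.
\<close>

lemma correlation_le_1:
  assumes r0: "r 0 = 1" and nonneg: "\<And>x y. Q r x y \<ge> 0"
    and corr: "\<And>m n. ((\<lambda>(x, y). Q r x y * (D m x * D n y)) has_sum (if m = n then r n / h n else 0)) UNIV"
  shows "\<bar>r n\<bar> \<le> 1"
proof -
  have EP_D: "EP (D k) = (if k = 0 then 1 else 0)" for k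
    using EP_D_orth[of k 0] by simp
  \<comment> \<open>The expectation of \<open>D k\<close> is its correlation with \<open>D 0\<close>
    = 1, namely 1 for k = 0 and 0 otherwise, under the joint law as under the Poisson law.\<close>
  have marg: "((\<lambda>(x, y). Q r x y * f x) has_sum EP f) UNIV" if "f \<in> W N" for f N
    using that
  proof (induction rule: W.induct)
    case zero
    show ?case by (simp add: EP_def)
  next
    case (step f k c)
    have "((\<lambda>z. (case z of (x, y) \<Rightarrow> Q r x y * f x) + c * (case z of (x, y) \<Rightarrow> Q r x y * (D k x * D 0 y)))
        has_sum (EP f + c * (if k = 0 then r 0 / h 0 else 0))) UNIV"
      using corr[of k 0] by (intro has_sum_add has_sum_cmult_right step.IH)
    also have "EP f + c * (if k = 0 then r 0 / h 0 else 0) = EP (\<lambda>x. f x + c * D k x)"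
      using W_exp_bounded[OF step.hyps(1)]
      by (simp add: EP_add EP_cmult EP_D exp_bounded_cmult exp_bounded_D r0)
    finally show ?case by (simp add: case_prod_unfold algebra_simps)
  qed
  obtain N where "(\<lambda>x. D n x * D n x) \<in> W N"
    using D_mult_W[OF W_D[of n "Suc (vec_total n)"]] by auto
  then have x: "((\<lambda>(x, y). Q r x y * (D n x)\<^sup>2) has_sum 1 / h n) UNIV"
    using marg[of "\<lambda>x. D n x * D n x"] by (simp add: EP_D_orth power2_eq_square)
  have y: "((\<lambda>(x, y). Q r x y * (D n y)\<^sup>2) has_sum 1 / h n) UNIV"
    using x unfolding UNIV_Times_UNIV[symmetric]
    by (subst has_sum_swap) (simp add: case_prod_unfold Q_commute[of r "snd _"])
  have "((\<lambda>z. 1 / 2 * ((case z of (x, y) \<Rightarrow> Q r x y * (D n x)\<^sup>2) + (case z of (x, y) \<Rightarrow> Q r x y * (D n y)\<^sup>2)))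
      has_sum (1 / 2 * (1 / h n + 1 / h n))) UNIV"
    by (intro has_sum_cmult_right has_sum_add x y)
  \<comment> \<open>The average of the two second moments, again 1/h_n, dominates the product with
    either sign.\<close>
  then have xy: "((\<lambda>(x, y). Q r x y * (((D n x)\<^sup>2 + (D n y)\<^sup>2) / 2)) has_sum 1 / h n) UNIV"
    by (simp add: case_prod_unfold algebra_simps add_divide_distrib)
  have le: "\<bar>D n x * D n y\<bar> \<le> ((D n x)\<^sup>2 + (D n y)\<^sup>2) / 2" for x y
  proof -
    have "2 * \<bar>D n x * D n y\<bar> \<le> (D n x)\<^sup>2 + (D n y)\<^sup>2"
      using sum_squares_bound[of "\<bar>D n x\<bar>" "\<bar>D n y\<bar>"] by (simp add: abs_mult mult.assoc)
    then show ?thesis by simp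
  qed
  have c: "((\<lambda>(x, y). Q r x y * (D n x * D n y)) has_sum r n / h n) UNIV"
    using corr[of n n] by simp
  have le1: "D n x * D n y \<le> ((D n x)\<^sup>2 + (D n y)\<^sup>2) / 2"
    and le2: "- (D n x * D n y) \<le> ((D n x)\<^sup>2 + (D n y)\<^sup>2) / 2" for x y
    using le[of x y] by linarith+
  have "r n / h n \<le> 1 / h n"
  proof (rule has_sum_mono[OF c xy])
    fix z :: "(nat ^ 'd) \<times> (nat ^ 'd)"
    show "(case z of (x, y) \<Rightarrow> Q r x y * (D n x * D n y)) \<le> (case z of (x, y) \<Rightarrow> Q r x y * (((D n x)\<^sup>2 + (D n y)\<^sup>2) / 2))"
      unfolding case_prod_unfold by (rule mult_left_mono[OF le1 nonneg])
  qed
  moreover have "- (r n / h n) \<le> 1 / h n"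
  proof (rule has_sum_mono[OF has_sum_uminusI[OF c] xy])
    fix z :: "(nat ^ 'd) \<times> (nat ^ 'd)"
    show "- (case z of (x, y) \<Rightarrow> Q r x y * (D n x * D n y)) \<le> (case z of (x, y) \<Rightarrow> Q r x y * (((D n x)\<^sup>2 + (D n y)\<^sup>2) / 2))"
      unfolding case_prod_unfold minus_mult_right[of "Q r (fst z) (snd z)"] by (rule mult_left_mono[OF le2 nonneg])
  qed
  ultimately have "\<bar>r n\<bar> / h n \<le> 1 / h n" by (auto simp: abs_if)
  then show ?thesis using h_pos[of n] by (simp add: divide_le_cancel)
qed

end

section \<open>The limiting law\<close>

text \<open>Markov's inequality for the N-th power bounds the probability of Y >= 1 + epsilon by (1
  + epsilon)^(-N), for every N.\<close>

lemma (in prob_space) AE_le_1_of_moments: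
  fixes Y :: "'a \<Rightarrow> real"
  assumes [measurable]: "Y \<in> borel_measurable M" and bd: "AE x in M. 0 \<le> Y x \<and> Y x \<le> B"
    and mom: "\<And>N. (\<integral>x. Y x ^ N \<partial>M) \<le> 1"
  shows "AE x in M. Y x \<le> 1"
proof -
  have int: "integrable M (\<lambda>x. Y x ^ N)" for N
  proof (rule integrable_const_bound[where B = "B ^ N"])
    show "AE x in M. norm (Y x ^ N) \<le> B ^ N"
      using bd by eventually_elim (auto simp: power_abs intro: power_mono)
  qed simp
  have small: "AE x in M. Y x < 1 + \<epsilon>" if "\<epsilon> > 0" for \<epsilon>
  proof -
    let ?S = "{x \<in> space M. Y x \<ge> 1 + \<epsilon>}"
    have "measure M ?S \<le> (1 / (1 + \<epsilon>)) ^ N" for N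
    proof -
      have "measure M ?S \<le> measure M {x \<in> space M. Y x ^ N \<ge> (1 + \<epsilon>) ^ N}"
        using that by (intro finite_measure_mono) (auto intro: power_mono)
      also have "\<dots> \<le> (\<integral>x. Y x ^ N \<partial>M) / (1 + \<epsilon>) ^ N"
      proof (rule integral_Markov_inequality_measure[OF int sets.top])
        show "AE x in M. 0 \<le> Y x ^ N" using bd by eventually_elim auto
      qed (use that in auto)
      also have "\<dots> \<le> 1 / (1 + \<epsilon>) ^ N"
        using that mom by (intro divide_right_mono) auto
      finally show ?thesis by (simp add: power_one_over)
    qed
    moreover have "(\<lambda>N. (1 / (1 + \<epsilon>)) ^ N) \<longlonglongrightarrow> 0"
      using that by (intro LIMSEQ_realpow_zero) auto
    ultimately have "measure M ?S \<le> 0"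
      by (intro LIMSEQ_le_const[of _ 0]) auto
    then have "measure M ?S = 0" by (simp add: measure_le_0_iff)
    then have "emeasure M ?S = 0" by (simp add: emeasure_eq_measure)
    then have "AE x in M. x \<notin> ?S" by (intro AE_not_in) (auto simp: null_sets_def)
    then show ?thesis using AE_space by eventually_elim auto
  qed
  have "AE x in M. \<forall>n. Y x < 1 + 1 / real (Suc n)"
    using small by (subst AE_all_countable) auto
  then show ?thesis
  proof eventually_elim
    case (elim x)
    show ?case
    proof (rule field_le_epsilon)
      fix e :: real assume "e > 0"
      then obtain n where "1 / real (Suc n) < e" using reals_Archimedean by (auto simp: inverse_eq_divide)
      with elim show "Y x \<le> 1 + e" by (meson add_left_mono less_imp_le order_trans)
    qed
  qed
qed

context hypergroup_basis
begin

text \<open>The scaling u^(r)_d = 1 makes all linear forms agree at m e_d, so every monomial of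
  degree |n| equals m^|n| there.\<close>

lemma U_axis: "U j (axis jd m) = m"
proof -
  have "U j (axis jd m) = (\<Sum>i\<in>UNIV. if i = jd then real m else 0)"
    unfolding U_def by (intro sum.cong) (auto simp: axis_def)
  then show ?thesis by simp
qed

lemma monp_const: "monp (\<lambda>j. c) n = c ^ vec_total n"
  by (simp add: monp_def power_vec_total)

lemma D_axis_limit:
  assumes "vec_total k < N"
  shows "(\<lambda>m. D k (axis jd m) / real m ^ N) \<longlonglongrightarrow> 0"
proof (rule Lim_null_comparison)
  define C where "C = (1 + 1 / M) ^ vec_total k / vfact k"
  show "\<forall>\<^sub>F m in sequentially. norm (D k (axis jd m) / real m ^ N) \<le> C * (1 / real m)"
    using eventually_ge_at_top[of 1]
  proof eventually_elim
    case (elim m)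
    have "1 + real m / M \<le> (1 + 1 / M) * real m"
      using elim by (simp add: algebra_simps)
    then have "(1 + real m / M) ^ vec_total k \<le> ((1 + 1 / M) * real m) ^ vec_total k"
      using M_pos by (intro power_mono) auto
    then have "(1 + real m / M) ^ vec_total k / vfact k \<le> C * real m ^ vec_total k"
      by (simp add: C_def power_mult_distrib divide_right_mono less_imp_le)
    with D_bound[of k "axis jd m"] have "\<bar>D k (axis jd m)\<bar> \<le> C * real m ^ vec_total k"
      by simp
    also have "\<dots> \<le> C * real m ^ (N - 1)"
      using assms elim M_pos by (intro mult_left_mono power_increasing) (auto simp: C_def less_imp_le)
    finally have "\<bar>D k (axis jd m)\<bar> / real m ^ N \<le> C * real m ^ (N - 1) / real m ^ N"
      by (intro divide_right_mono) auto
    also have "\<dots> = C * (1 / real m)"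
      using assms elim by (cases N) (auto simp: field_simps)
    finally show ?case by simp
  qed
  have "(\<lambda>m. C * (1 / real m)) \<longlonglongrightarrow> C * 0"
    by (intro tendsto_mult tendsto_const lim_1_over_n)
  then show "(\<lambda>m. C * (1 / real m)) \<longlonglongrightarrow> 0" by simp
qed

lemma W_axis_limit: "f \<in> W N \<Longrightarrow> (\<lambda>m. f (axis jd m) / real m ^ N) \<longlonglongrightarrow> 0"
proof (induction rule: W.induct)
  case (step f k c)
  have "(\<lambda>m. f (axis jd m) / real m ^ N + c * (D k (axis jd m) / real m ^ N)) \<longlonglongrightarrow> 0 + c * 0"
    by (intro tendsto_intros step D_axis_limit)
  then show ?case by (simp add: add_divide_distrib)
qed simp

text \<open>The conditional laws given that the other vector is \<open>axis jd m\<close>.\<close>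

lemma conditional_laws:
  assumes r: "\<And>n. \<bar>r n\<bar> \<le> 1" and r0: "r 0 = 1" and nonneg: "\<And>x y. Q r x y \<ge> 0"
  obtains q :: "nat \<Rightarrow> (nat ^ 'd) pmf" where "\<And>m k. integrable (q m) (D k)"
    and "\<And>m k. measure_pmf.expectation (q m) (D k) = r k * D k (axis jd m)"
proof -
  have hs: "((\<lambda>x. Q r x (axis jd m) / P (axis jd m) * D k x) has_sum (r k * D k (axis jd m))) UNIV" for m k
    using has_sum_cmult_right[OF Q_eigen_left[of r "axis jd m" k, OF r], of "1 / P (axis jd m)"] P_pos[of "axis jd m"]
    by (simp add: mult_ac)
  have "\<exists>p. \<forall>x. pmf p x = Q r x (axis jd m) / P (axis jd m)" for m
  proof (rule has_sum_imp_pmf[of "\<lambda>x. Q r x (axis jd m) / P (axis jd m)"])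
    show "0 \<le> Q r x (axis jd m) / P (axis jd m)" for x
      using nonneg P_pos by (intro divide_nonneg_pos)
    show "((\<lambda>x. Q r x (axis jd m) / P (axis jd m)) has_sum 1) UNIV"
      using hs[of m 0] by (simp add: r0)
  qed blast
  then obtain q where q: "\<And>m x. pmf (q m) x = Q r x (axis jd m) / P (axis jd m)"
    by metis
  have "((\<lambda>x. pmf (q m) x * D k x) has_sum (r k * D k (axis jd m))) UNIV" for m k
    unfolding q by (rule hs)
  from pmf_expectation_has_sum[OF this] show ?thesis by (rule that[of q])
qed

text \<open>Elements of \<open>W N\<close> have expectation o(m^N), being combinations of r_k D_k(m
  e_d) with |k| < N. Hence only the leading term counts, and its conditional mean is r_n times its
  value at m e_d.\<close>

lemma limit_moments:
  assumes int: "\<And>m k. integrable (measure_pmf (q m)) (D k)"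
    and ex: "\<And>m k. measure_pmf.expectation (q m) (D k) = r k * D k (axis jd m)"
    and r: "\<And>n. \<bar>r n\<bar> \<le> 1"
  shows "integrable (measure_pmf (q m)) (\<lambda>x. monp (\<lambda>j. U j x) n)"
    and "(\<lambda>m. measure_pmf.expectation (q m) (\<lambda>x. monp (\<lambda>j. U j x) n) / real m ^ vec_total n) \<longlonglongrightarrow> r n"
proof -
  have W_int: "integrable (measure_pmf (q m)) f" if "f \<in> W N" for f N m
    using that
  proof (induction rule: W.induct)
    case (step f k c)
    show ?case
      by (rule Bochner_Integration.integrable_add[OF step.IH integrable_mult_right[OF int]])
  qed simp
  have W_lim: "(\<lambda>m. measure_pmf.expectation (q m) f / real m ^ N) \<longlonglongrightarrow> 0" if "f \<in> W N" for f N
    using that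
  proof (induction rule: W.induct)
    case (step f k c)
    have "(\<lambda>m. measure_pmf.expectation (q m) f / real m ^ N + c * r k * (D k (axis jd m) / real m ^ N)) \<longlonglongrightarrow> 0 + c * r k * 0"
      by (intro tendsto_intros step D_axis_limit)
    then show ?case
      using W_int[OF step.hyps(1)] int by (simp add: ex add_divide_distrib mult.assoc)
  qed simp
  define C where "C = M ^ vec_total n * vfact n"
  define g where "g x = monp (\<lambda>j. U j x) n - C * D n x" for x
  have g: "g \<in> W (vec_total n)"
    using monp_U_leading[of n] by (simp add: g_def[abs_def] C_def)
  have mg: "monp (\<lambda>j. U j x) n = C * D n x + g x" for x
    by (simp add: g_def)
  show "integrable (measure_pmf (q m)) (\<lambda>x. monp (\<lambda>j. U j x) n)"
    unfolding mg using W_int[OF g] int by auto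
  have lim: "(\<lambda>m. r n * (1 - g (axis jd m) / real m ^ vec_total n)
      + measure_pmf.expectation (q m) g / real m ^ vec_total n) \<longlonglongrightarrow> r n * (1 - 0) + 0"
    by (intro tendsto_intros W_axis_limit W_lim g)
  have "\<forall>\<^sub>F m in sequentially. r n * (1 - g (axis jd m) / real m ^ vec_total n)
      + measure_pmf.expectation (q m) g / real m ^ vec_total n
      = measure_pmf.expectation (q m) (\<lambda>x. monp (\<lambda>j. U j x) n) / real m ^ vec_total n"
    using eventually_gt_at_top[of 0]
  proof eventually_elim
    case (elim m)
    have "measure_pmf.expectation (q m) (\<lambda>x. monp (\<lambda>j. U j x) n)
        = r n * (C * D n (axis jd m)) + measure_pmf.expectation (q m) g"
      unfolding mg using W_int[OF g] int by (simp add: ex)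
    moreover have "C * D n (axis jd m) = real m ^ vec_total n - g (axis jd m)"
      by (simp add: g_def U_axis monp_const)
    ultimately show ?case using elim by (simp add: field_simps)
  qed
  with lim show "(\<lambda>m. measure_pmf.expectation (q m) (\<lambda>x. monp (\<lambda>j. U j x) n) / real m ^ vec_total n) \<longlonglongrightarrow> r n"
    by (simp add: tendsto_cong)
qed

lemma monp_U_abs_le: "\<bar>monp (\<lambda>j. U j x) n\<bar> \<le> real (vec_total x) ^ vec_total n"
proof -
  have "\<bar>U j x\<bar> \<le> real (vec_total x)" for j
  proof -
    have "\<bar>U j x\<bar> \<le> (\<Sum>i\<in>UNIV. \<bar>x $ i * u j $ i\<bar>)"
      unfolding U_def by (rule sum_abs)
    also have "\<dots> \<le> (\<Sum>i\<in>UNIV. real (x $ i))"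
      by (intro sum_mono) (auto simp: abs_mult intro: mult_left_le u_abs_le_1)
    finally show ?thesis by (simp add: vec_total_def)
  qed
  then have "\<bar>monp (\<lambda>j. U j x) n\<bar> \<le> (\<Prod>j\<in>UNIV. real (vec_total x) ^ (n $ j))"
    unfolding monp_def abs_prod by (intro prod_mono) (auto simp: power_abs intro: power_mono)
  then show ?thesis by (simp add: power_vec_total)
qed

lemma monp_axis: "monp c (axis j N) = c j ^ N"
proof -
  have "monp c (axis j N) = (\<Prod>i\<in>UNIV. if i = j then c j ^ N else 1)"
    unfolding monp_def by (intro prod.cong) (auto simp: axis_def)
  then show ?thesis by simp
qed

lemma U_l0: "U l0 x = vec_total x"
  by (simp add: U_def vec_total_def)

text \<open>
  Replacing the rescaled vector by zero on the event \<open>vec_total x > 2 * m\<close> does not affect the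
  limits of the moments: the error is at most $2^{-k}$ times a limiting moment, for every $k$.
\<close>

lemma truncated_limit_moments:
  assumes int: "\<And>m k. integrable (measure_pmf (q m)) (D k)"
    and ex: "\<And>m k. measure_pmf.expectation (q m) (D k) = r k * D k (axis jd m)"
    and r: "\<And>n. \<bar>r n\<bar> \<le> 1"
  shows "(\<lambda>m. measure_pmf.expectation (q m)
      (\<lambda>x. if vec_total x \<le> 2 * m then monp (\<lambda>j. U j x) n else 0) / real m ^ vec_total n) \<longlonglongrightarrow> r n"
proof -
  note lm = limit_moments[OF int ex r]
  let ?E = "\<lambda>m. measure_pmf.expectation (q m)"
  define b where "b N m = ?E m (\<lambda>x. monp (\<lambda>j. U j x) (axis l0 N)) / real m ^ N" for N m
  have b_lim: "(\<lambda>m. b N m) \<longlonglongrightarrow> r (axis l0 N)" for N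
    using lm(2)[of "axis l0 N"] by (simp add: b_def)
  define f where "f m = ?E m (\<lambda>x. if vec_total x \<le> 2 * m then monp (\<lambda>j. U j x) n else 0) / real m ^ vec_total n" for m
  define e where "e m = ?E m (\<lambda>x. monp (\<lambda>j. U j x) n) / real m ^ vec_total n" for m
  \<comment> \<open>Off the event (|x|/2m)^k >= 1. Multiplying the bound |x|^|n| by this factor
    gives a moment of \<open>U l0\<close> = |x| of order |n| + k, with 2^(-k) left over.\<close>
  have diff: "\<bar>e m - f m\<bar> \<le> (1 / 2) ^ k * b (vec_total n + k) m" if "m > 0" for m k
  proof -
    let ?g = "\<lambda>x. monp (\<lambda>j. U j x) n" and ?t = "\<lambda>x. if vec_total x \<le> 2 * m then monp (\<lambda>j. U j x) n else 0"
    let ?c = "\<lambda>x. (1 / (2 * real m)) ^ k * monp (\<lambda>j. U j x) (axis l0 (vec_total n + k))"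
    have it: "integrable (measure_pmf (q m)) ?t"
      by (rule Bochner_Integration.integrable_bound[OF lm(1)[of m n]]) auto
    have "\<bar>?g x - ?t x\<bar> \<le> ?c x" for x
    proof (cases "vec_total x \<le> 2 * m")
      case True
      then show ?thesis by (auto simp: monp_axis U_l0)
    next
      case False
      then have "1 \<le> real (vec_total x) / (2 * real m)"
        using that by (simp add: divide_simps)
      then have "1 \<le> (real (vec_total x) / (2 * real m)) ^ k" by (rule one_le_power)
      then have "real (vec_total x) ^ vec_total n * 1 \<le> real (vec_total x) ^ vec_total n * (real (vec_total x) / (2 * real m)) ^ k"
        by (intro mult_left_mono) auto
      also have "\<dots> = ?c x" by (simp add: monp_axis U_l0 power_add power_divide)
      finally show ?thesis using monp_U_abs_le[of x n] False by simp
    qed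
    then have "\<bar>?E m (\<lambda>x. ?g x - ?t x)\<bar> \<le> ?E m ?c"
      using it lm(1) by (intro order_trans[OF integral_abs_bound] integral_mono) auto
    then have "\<bar>?E m ?g - ?E m ?t\<bar> \<le> (1 / (2 * real m)) ^ k * ?E m (\<lambda>x. monp (\<lambda>j. U j x) (axis l0 (vec_total n + k)))"
      using it lm(1) by simp
    then have "\<bar>?E m ?g - ?E m ?t\<bar> / real m ^ vec_total n
        \<le> (1 / (2 * real m)) ^ k * ?E m (\<lambda>x. monp (\<lambda>j. U j x) (axis l0 (vec_total n + k))) / real m ^ vec_total n"
      by (rule divide_right_mono) simp
    moreover have "\<bar>e m - f m\<bar> = \<bar>?E m ?g - ?E m ?t\<bar> / real m ^ vec_total n"
      by (simp add: e_def f_def flip: diff_divide_distrib)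
    ultimately show ?thesis
      by (simp add: b_def power_add power_divide power_mult_distrib mult_ac)
  qed
  have "(\<lambda>m. e m - f m) \<longlonglongrightarrow> 0"
  proof (rule LIMSEQ_I)
    fix \<epsilon> :: real assume \<epsilon>: "\<epsilon> > 0"
    \<comment> \<open>The limiting moments are at most 1, so those along the sequence are eventually
      below 2; this is the factor 2 in the choice of k.\<close>
    obtain k where k: "(1 / 2 :: real) ^ k < \<epsilon> / 2"
      using real_arch_pow_inv[of "\<epsilon> / 2" "1 / 2"] \<epsilon> by auto
    have "r (axis l0 (vec_total n + k)) < 2" using r[of "axis l0 (vec_total n + k)"] by linarith
    from order_tendstoD(2)[OF b_lim this]
    have "\<forall>\<^sub>F m in sequentially. norm (e m - f m - 0) < \<epsilon>"
      using eventually_gt_at_top[of 0]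
    proof eventually_elim
      case (elim m)
      have "\<bar>e m - f m\<bar> \<le> (1 / 2) ^ k * b (vec_total n + k) m" by (rule diff) (use elim in simp)
      also have "\<dots> \<le> (1 / 2) ^ k * 2" using elim by (intro mult_left_mono) auto
      also have "\<dots> < \<epsilon>" using k by simp
      finally show ?case by simp
    qed
    then show "\<exists>N. \<forall>m\<ge>N. norm (e m - f m - 0) < \<epsilon>" by (simp add: eventually_sequentially)
  qed
  moreover have "e \<longlonglongrightarrow> r n" unfolding e_def[abs_def] by (rule lm(2))
  ultimately have "(\<lambda>m. e m - (e m - f m)) \<longlonglongrightarrow> r n - 0" by (intro tendsto_diff)
  then show ?thesis by (simp add: f_def)
qed

lemma continuous_monp_lin: "continuous_on UNIV (\<lambda>\<xi>. monp (lin \<xi>) n)"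
  unfolding monp_def lin_def by (intro continuous_intros)

lemma nonneg_imp_mixture:
  assumes r: "\<And>n. \<bar>r n\<bar> \<le> 1" and r0: "r 0 = 1" and nonneg: "\<And>x y. Q r x y \<ge> 0"
  obtains \<nu> where "prob_space \<nu>" "sets \<nu> = sets borel" "AE \<xi> in \<nu>. \<xi> \<in> unit_simplex"
    "\<And>n. r n = (\<integral>\<xi>. monp (lin \<xi>) n \<partial>\<nu>)"
proof -
  obtain q :: "nat \<Rightarrow> (nat ^ 'd) pmf" where int: "\<And>m k. integrable (q m) (D k)"
    and ex: "\<And>m k. measure_pmf.expectation (q m) (D k) = r k * D k (axis jd m)"
    using conditional_laws[OF assms] by blast
  \<comment> \<open>On the event x_i <= 2m, so division by 4m keeps each coordinate strictly below
    1, as the curve requires. The scaling by 4 in \<nu> undoes this. For m = 0 division by zero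
    gives the zero vector.\<close>
  define X :: "nat \<Rightarrow> nat ^ 'd \<Rightarrow> real ^ 'd"
    where "X m x = (if vec_total x \<le> 2 * m then \<chi> i. x $ i / (4 * m) else 0)" for m x
  have X: "0 \<le> X m x $ i \<and> X m x $ i < 1" for m x i
  proof (cases "vec_total x \<le> 2 * m \<and> m > 0")
    case True
    have "x $ i \<le> vec_total x" unfolding vec_total_def by (intro member_le_sum) auto
    then have "real (x $ i) < 4 * real m" using True by linarith
    then show ?thesis using True by (auto simp: X_def divide_less_eq)
  next
    case False
    then show ?thesis by (auto simp: X_def)
  qed
  obtain \<sigma> \<nu>' where \<sigma>: "strict_mono \<sigma>" and \<nu>': "prob_space \<nu>'" and sets: "sets \<nu>' = sets borel"
    and cube: "AE z in \<nu>'. \<forall>i. 0 \<le> z $ i \<and> z $ i \<le> 1"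
    and lim: "\<And>f :: real ^ 'd \<Rightarrow> real. continuous_on UNIV f \<Longrightarrow>
      (\<lambda>m. measure_pmf.expectation (q (\<sigma> m)) (\<lambda>x. f (X (\<sigma> m) x))) \<longlonglongrightarrow> integral\<^sup>L \<nu>' f"
    using cube_laws_compact[of X q, OF X] by blast
  interpret N': prob_space \<nu>' by fact
  have meas4: "(\<lambda>z. 4 *\<^sub>R z) \<in> measurable \<nu>' (borel :: (real ^ 'd) measure)"
    by (subst measurable_cong_sets[OF sets refl]) simp
  define \<nu> where "\<nu> = distr \<nu>' borel (\<lambda>z. 4 *\<^sub>R z)"
  have prob: "prob_space \<nu>" unfolding \<nu>_def by (rule N'.prob_space_distr[OF meas4])
  interpret N: prob_space \<nu> by fact
  have sets\<nu>: "sets \<nu> = sets borel" by (simp add: \<nu>_def)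
  have moments: "r n = (\<integral>\<xi>. monp (lin \<xi>) n \<partial>\<nu>)" for n
  proof -
    let ?f = "\<lambda>z. monp (lin (4 *\<^sub>R z)) n"
    have "(\<lambda>m. measure_pmf.expectation (q (\<sigma> m)) (\<lambda>x. ?f (X (\<sigma> m) x))) \<longlonglongrightarrow> integral\<^sup>L \<nu>' ?f"
      by (intro lim continuous_on_compose2[OF continuous_monp_lin] continuous_intros) auto
    moreover have "(\<lambda>m. measure_pmf.expectation (q (\<sigma> m)) (\<lambda>x. ?f (X (\<sigma> m) x))) \<longlonglongrightarrow> r n"
    \<comment> \<open>Off the event X is 0, where the monomial is 0 only for n nonzero; for n = 0 it
      is 1 and does not match the truncated integrand.\<close>
    proof (cases "n = 0")
      case True
      then show ?thesis by (simp add: r0)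
    next
      case False
      define g where "g m = measure_pmf.expectation (q m)
        (\<lambda>x. if vec_total x \<le> 2 * m then monp (\<lambda>j. U j x) n else 0) / real m ^ vec_total n" for m
      have eq: "measure_pmf.expectation (q m) (\<lambda>x. ?f (X m x)) = g m" for m
      proof -
        have "?f (X m x) = (if vec_total x \<le> 2 * m then monp (\<lambda>j. U j x) n else 0) / real m ^ vec_total n" for x
        proof (cases "vec_total x \<le> 2 * m")
          case True
          have "lin (4 *\<^sub>R X m x) j = U j x / m" for j
            using True by (simp add: lin_def U_def X_def sum_divide_distrib mult_ac)
          then show ?thesis
            using True by (simp add: monp_def power_divide prod_dividef power_vec_total)
        next
          case False
          obtain j where "n $ j \<noteq> 0" using \<open>n \<noteq> 0\<close> by (auto simp: vec_eq_iff)
          then have "monp (\<lambda>j. 0) n = 0" unfolding monp_def by (intro prod_zero) auto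
          then show ?thesis using False by (simp add: X_def lin_def[abs_def])
        qed
        then show ?thesis by (simp add: g_def)
      qed
      have "g \<longlonglongrightarrow> r n"
        unfolding g_def[abs_def] by (rule truncated_limit_moments[OF int ex r])
      then show ?thesis unfolding eq by (rule LIMSEQ_subseq_LIMSEQ[OF _ \<sigma>, unfolded o_def])
    qed
    ultimately have "r n = integral\<^sup>L \<nu>' ?f" by (rule LIMSEQ_unique[symmetric])
    also have "\<dots> = (\<integral>\<xi>. monp (lin \<xi>) n \<partial>\<nu>)"
      unfolding \<nu>_def by (rule integral_distr[symmetric, OF meas4]) simp
    finally show ?thesis .
  qed
  have box: "cbox 0 (\<chi> i. (4 :: real)) = {\<xi> :: real ^ 'd. \<forall>i. 0 \<le> \<xi> $ i \<and> \<xi> $ i \<le> 4}"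
    by (auto simp: mem_box_cart)
  have "AE \<xi> in \<nu>. \<xi> \<in> cbox 0 (\<chi> i. (4 :: real))"
    unfolding \<nu>_def
  proof (subst AE_distr_iff[OF meas4])
    show "{x \<in> space borel. x \<in> cbox 0 (\<chi> i. (4 :: real))} \<in> sets (borel :: (real ^ 'd) measure)"
      by simp
    show "AE z in \<nu>'. 4 *\<^sub>R z \<in> cbox 0 (\<chi> i. (4 :: real))"
      using cube by eventually_elim (auto simp: box)
  qed
  then have pos: "AE \<xi> in \<nu>. \<forall>i. 0 \<le> \<xi> $ i \<and> \<xi> $ i \<le> 4"
    by (simp add: box)
  \<comment> \<open>\<open>lin \<xi> l0\<close> is |xi|, whose N-th moment is r at N e_{l0}, hence
    at most 1. The crude bound 4d from the cube only secures integrability.\<close>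
  have "AE \<xi> in \<nu>. lin \<xi> l0 \<le> 1"
  proof (rule N.AE_le_1_of_moments)
    show "(\<lambda>\<xi>. lin \<xi> l0) \<in> borel_measurable \<nu>"
      by (subst measurable_cong_sets[OF sets\<nu> refl]) simp
    show "AE \<xi> in \<nu>. 0 \<le> lin \<xi> l0 \<and> lin \<xi> l0 \<le> 4 * real CARD('d)"
      using pos
    proof eventually_elim
      case (elim \<xi>)
      then have "(\<Sum>i\<in>UNIV. \<xi> $ i) \<le> (\<Sum>i\<in>(UNIV :: 'd set). 4)" by (intro sum_mono) auto
      with elim show ?case by (auto simp: lin_l0 vec_total_def intro: sum_nonneg)
    qed
    show "(\<integral>\<xi>. lin \<xi> l0 ^ N \<partial>\<nu>) \<le> 1" for N
      using moments[of "axis l0 N"] r[of "axis l0 N"] by (simp add: monp_axis abs_le_iff)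
  qed
  with pos have "AE \<xi> in \<nu>. \<xi> \<in> unit_simplex"
    by eventually_elim (simp add: unit_simplex_def lin_l0)
  then show ?thesis using that prob sets\<nu> moments by blast
qed

end

theorem theorem3:
  fixes \<mu> :: "real ^ 'd" and u :: "'d \<Rightarrow> real ^ 'd" and a :: "'d \<Rightarrow> real"
    and \<rho> :: "nat ^ 'd \<Rightarrow> real" and l0 jd :: 'd
  assumes "CARD('d) \<ge> 2"
    and "\<And>i. \<mu> $ i > 0"
    and "orthogonal_basis (\<chi> i. \<mu> $ i / vec_total \<mu>) u a"
    and "\<And>i. u l0 $ i = 1"
    and "\<And>r. u r $ jd = 1"
    and "\<And>j k l. hypergroup_kernel u a j k l \<ge> 0"
    and "\<rho> 0 = 1"
  shows
    "(lancaster_expansion l0 \<mu> u a \<rho> \<and> (\<forall>x y. lancaster l0 \<mu> u a \<rho> x y \<ge> 0) \<longleftrightarrow>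
        (\<exists>\<nu> :: (real ^ 'd) measure.
           prob_space \<nu> \<and> sets \<nu> = sets borel \<and> (AE \<xi> in \<nu>. \<xi> \<in> unit_simplex) \<and>
           (\<forall>n. \<rho> n = (\<integral>\<xi>. (\<Prod>j\<in>UNIV. (\<Sum>i\<in>UNIV. u j $ i * \<xi> $ i) ^ (n $ j)) \<partial>\<nu>))))
     \<and> (lancaster_expansion l0 \<mu> u a \<rho> \<and> (\<forall>x y. lancaster l0 \<mu> u a \<rho> x y \<ge> 0) \<longrightarrow>
        (\<exists>q. bivariate_poisson \<mu> q \<and> (\<forall>x y. pmf q (x, y) = lancaster l0 \<mu> u a \<rho> x y)))"
proof -
  interpret hypergroup_basis \<mu> u a l0 jd
    by unfold_locales (use assms in auto)
  let ?mixture = "\<lambda>\<nu> :: (real ^ 'd) measure.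
    prob_space \<nu> \<and> sets \<nu> = sets borel \<and> (AE \<xi> in \<nu>. \<xi> \<in> unit_simplex) \<and>
    (\<forall>n. \<rho> n = (\<integral>\<xi>. (\<Prod>j\<in>UNIV. (\<Sum>i\<in>UNIV. u j $ i * \<xi> $ i) ^ (n $ j)) \<partial>\<nu>))"
  have mixture_iff: "?mixture \<nu> \<longleftrightarrow> prob_space \<nu> \<and> sets \<nu> = sets borel \<and>
      (AE \<xi> in \<nu>. \<xi> \<in> unit_simplex) \<and> (\<forall>n. \<rho> n = (\<integral>\<xi>. monp (lin \<xi>) n \<partial>\<nu>))" for \<nu>
    by (simp add: monp_def lin_def)
  have forward: "(\<exists>\<nu>. ?mixture \<nu>) \<and> (\<exists>q. bivariate_poisson \<mu> q \<and> (\<forall>x y. pmf q (x, y) = lancaster l0 \<mu> u a \<rho> x y))"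
    if exp: "lancaster_expansion l0 \<mu> u a \<rho>" and nonneg: "\<forall>x y. lancaster l0 \<mu> u a \<rho> x y \<ge> 0"
  proof -
    have eq: "lancaster l0 \<mu> u a \<rho> x y = Q \<rho> x y" for x y
      using exp \<open>\<rho> 0 = 1\<close> by (intro lancaster_eq_Q) (auto simp: lancaster_expansion_def)
    have Q: "Q \<rho> x y \<ge> 0" for x y using nonneg by (simp add: eq)
    \<comment> \<open>Passing between C and D costs the sign (-1)^(m_0 + n_0), which is 1 on the
      diagonal.\<close>
    have "((\<lambda>(x, y). Q \<rho> x y * (D m x * D n y)) has_sum (if m = n then \<rho> n / h n else 0)) UNIV" for m n
    proof -
      have "((\<lambda>(x, y). Q \<rho> x y * (charlier l0 \<mu> u m x * charlier l0 \<mu> u n y))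
          has_sum (if m = n then \<rho> n * inverse (h n) else 0)) UNIV"
        using exp unfolding lancaster_expansion_def eq by blast
      from has_sum_cmult_right[OF this, of "(- 1) ^ (m $ l0) * (- 1) ^ (n $ l0)"]
      have "((\<lambda>(x, y). Q \<rho> x y * (D m x * D n y))
          has_sum ((- 1) ^ (m $ l0) * (- 1) ^ (n $ l0) * (if m = n then \<rho> n * inverse (h n) else 0))) UNIV"
        by (simp add: D_def case_prod_unfold mult_ac)
      also have "(- 1) ^ (m $ l0) * (- 1) ^ (n $ l0) * (if m = n then \<rho> n * inverse (h n) else 0)
          = (if m = n then \<rho> n / h n else 0)"
        by (simp add: divide_inverse flip: power_mult_distrib)
      finally show ?thesis .
    qed
    \<comment> \<open>The correlation clause of the expansion enters through this bound, which makes
      the series absolutely convergent and opens the way to the eigenvalue relations.\<close>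
    then have r1: "\<bar>\<rho> n\<bar> \<le> 1" for n
      using \<open>\<rho> 0 = 1\<close> Q by (intro correlation_le_1)
    have "\<exists>\<nu>. ?mixture \<nu>"
      unfolding mixture_iff using nonneg_imp_mixture[of \<rho>, OF r1 \<open>\<rho> 0 = 1\<close> Q] by metis
    moreover obtain q where "bivariate_poisson \<mu> q" "\<And>x y. pmf q (x, y) = Q \<rho> x y"
      using Q_pmf[of \<rho>, OF r1 \<open>\<rho> 0 = 1\<close> Q] by blast
    ultimately show ?thesis by (auto simp: eq)
  qed
  have backward: "lancaster_expansion l0 \<mu> u a \<rho> \<and> (\<forall>x y. lancaster l0 \<mu> u a \<rho> x y \<ge> 0)" if "?mixture \<nu>" for \<nu>
  proof -
    from that have \<nu>: "prob_space \<nu>" "sets \<nu> = sets borel" "AE \<xi> in \<nu>. \<xi> \<in> unit_simplex"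
      and moments: "\<And>n. \<rho> n = (\<integral>\<xi>. monp (lin \<xi>) n \<partial>\<nu>)"
      unfolding mixture_iff by blast+
    note mm = mixture_moments[of \<nu> \<rho>, OF \<nu> moments]
    have Q: "Q \<rho> x y \<ge> 0" for x y
      using mm(2)[of x y] P_pos[of x] P_pos[of y] by (simp add: Q_def)
    show ?thesis
      using lancaster_expansion_Q[of \<rho>, OF mm(1) \<open>\<rho> 0 = 1\<close> Q] Q by simp
  qed
  show ?thesis using forward backward by blast
qed

end
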